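(* Let $\Lambda$ be a CSP (a finite collection of predicates over a finite domain $[q]$). If there is an $\alpha$ approximation algorithm for unweighted regular instances of Max-CSP $\Lambda$, then for every $\delta>0$ there is an $\alpha-\delta$ approximation algorithm for weighted instances of Max-CSP $\Lambda$ (with no regularity requirement).
   Context: A CSP over the language $\Sigma=[q]$, $q\in\mathbb{N}$, is a finite collection $\Lambda$ of predicates $P:[q]^k\to\{0,1\}$ (with $k=\mathrm{ar}(P)$ varying). An instance of $\Lambda$ consists of variables $x_1,\dots,x_n$ taking values in $\Sigma$ and constraints $C_1,\dots,C_m$, where $C_r=(P_r,S_r)$ with $P_r\in\Lambda$ and $S_r$ an ordered tuple of $\mathrm{ar}(P_r)$ distinct variables (the scope). In a weighted instance each constraint has a weight $w_r\ge 0$ with $\sum_r w_r=1$; an unweighted instance is one with $w_r=1/m$ for all $r$. The degree of a variable $x_i$ is the number of constraints whose scope contains $x_i$; an instance is regular if all variables have the same degree. For an assignment $\chi:\{x_1,\dots,x_n\}\to\Sigma$, $\mathrm{Val}_\chi(\mathcal F)=\sum_r w_r P_r(\chi(S_r))$. For Max-CSP $\Lambda$, $\mathrm{Opt}(\mathcal F)=\max_\chi \mathrm{Val}_\chi(\mathcal F)$, and an $\alpha$ approximation algorithm (for a given class of instances) is a polynomial-time algorithm that on each instance $\mathcal F$ of the class outputs an assignment $\chi$ with $\mathrm{Val}_\chi(\mathcal F)\ge \alpha\cdot\mathrm{Opt}(\mathcal F)$ (by convention $\alpha<1$). *)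

theory Defs
  imports Complex_Main "HOL-Computational_Algebra.Polynomial"
begin

section \<open>Polynomial-time computation\<close>

text \<open>
  Algorithms are programs of the WHILE language over binary trees (N. D. Jones, \<^emph>\<open>Computability
  and Complexity from a Programming Perspective\<close>). Time is charged as follows: one unit per
  executed command or loop test, plus the sizes of all intermediate values of every evaluated
  expression. Charging for sizes, rather than one unit per operation as with shared
  pointers, keeps every stored value no larger than the initial store plus the elapsed time.
  Turing machines and WHILE programs therefore simulate one another with polynomial overhead.
\<close>

datatype tree = Leaf | Node tree tree

fun tree_size :: "tree \<Rightarrow> nat" where
  "tree_size Leaf = 1"
| "tree_size (Node l r) = 1 + tree_size l + tree_size r"

fun left :: "tree \<Rightarrow> tree" where
  "left Leaf = Leaf"
| "left (Node l r) = l"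

fun right :: "tree \<Rightarrow> tree" where
  "right Leaf = Leaf"
| "right (Node l r) = r"

datatype expr = EVar nat | ELeaf | ENode expr expr | ELeft expr | ERight expr | EEq expr expr

datatype com = Skip | Assign nat expr | Seq com com | Cond expr com com | While expr com

type_synonym store = "nat \<Rightarrow> tree"

text \<open>As a truth value, \<^const>\<open>Leaf\<close> is false and every other tree is true.\<close>

fun eval :: "expr \<Rightarrow> store \<Rightarrow> tree" where
  "eval (EVar x) s = s x"
| "eval ELeaf s = Leaf"
| "eval (ENode e f) s = Node (eval e s) (eval f s)"
| "eval (ELeft e) s = left (eval e s)"
| "eval (ERight e) s = right (eval e s)"
| "eval (EEq e f) s = (if eval e s = eval f s then Node Leaf Leaf else Leaf)"

fun cost :: "expr \<Rightarrow> store \<Rightarrow> nat" where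
  "cost (EVar x) s = tree_size (eval (EVar x) s)"
| "cost ELeaf s = tree_size (eval ELeaf s)"
| "cost (ENode e f) s = tree_size (eval (ENode e f) s) + cost e s + cost f s"
| "cost (ELeft e) s = tree_size (eval (ELeft e) s) + cost e s"
| "cost (ERight e) s = tree_size (eval (ERight e) s) + cost e s"
| "cost (EEq e f) s = tree_size (eval (EEq e f) s) + cost e s + cost f s"

text \<open>\<open>exec c s t s'\<close>: started in \<open>s\<close>, the program \<open>c\<close> halts in \<open>s'\<close> after time \<open>t\<close>.\<close>

inductive exec :: "com \<Rightarrow> store \<Rightarrow> nat \<Rightarrow> store \<Rightarrow> bool" where
  Skip: "exec Skip s 1 s"
| Assign: "exec (Assign x e) s (1 + cost e s) (s(x := eval e s))"
| Seq: "exec c\<^sub>1 s t\<^sub>1 s' \<Longrightarrow> exec c\<^sub>2 s' t\<^sub>2 s'' \<Longrightarrow> exec (Seq c\<^sub>1 c\<^sub>2) s (1 + t\<^sub>1 + t\<^sub>2) s''"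
| CondTrue: "eval e s \<noteq> Leaf \<Longrightarrow> exec c\<^sub>1 s t s' \<Longrightarrow> exec (Cond e c\<^sub>1 c\<^sub>2) s (1 + cost e s + t) s'"
| CondFalse: "eval e s = Leaf \<Longrightarrow> exec c\<^sub>2 s t s' \<Longrightarrow> exec (Cond e c\<^sub>1 c\<^sub>2) s (1 + cost e s + t) s'"
| WhileFalse: "eval e s = Leaf \<Longrightarrow> exec (While e c) s (1 + cost e s) s"
| WhileTrue: "eval e s \<noteq> Leaf \<Longrightarrow> exec c s t\<^sub>1 s' \<Longrightarrow> exec (While e c) s' t\<^sub>2 s'' \<Longrightarrow>
    exec (While e c) s (1 + cost e s + t\<^sub>1 + t\<^sub>2) s''"

inductive_cases exec_SkipE: "exec Skip s t s'"
inductive_cases exec_AssignE: "exec (Assign x e) s t s'"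
inductive_cases exec_SeqE: "exec (Seq c\<^sub>1 c\<^sub>2) s t s'"
inductive_cases exec_CondE: "exec (Cond e c\<^sub>1 c\<^sub>2) s t s'"
inductive_cases exec_WhileE: "exec (While e c) s t s'"

lemma exec_deterministic:
  "exec c s t s' \<Longrightarrow> exec c s u s'' \<Longrightarrow> u = t \<and> s'' = s'"
proof (induction arbitrary: u s'' rule: exec.induct)
  case (Skip s)
  then show ?case by (auto elim: exec_SkipE)
next
  case (Assign x e s)
  then show ?case by (auto elim: exec_AssignE)
next
  case (Seq c\<^sub>1 s t\<^sub>1 s\<^sub>1 c\<^sub>2 t\<^sub>2 s\<^sub>2)
  from Seq.prems show ?case by (rule exec_SeqE) (auto dest!: Seq.IH)
next
  case (CondTrue e s c\<^sub>1 t s\<^sub>1 c\<^sub>2)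
  from CondTrue.prems show ?case by (rule exec_CondE) (auto simp: CondTrue.hyps dest!: CondTrue.IH)
next
  case (CondFalse e s c\<^sub>2 t s\<^sub>1 c\<^sub>1)
  from CondFalse.prems show ?case by (rule exec_CondE) (auto simp: CondFalse.hyps dest!: CondFalse.IH)
next
  case (WhileFalse e s c)
  from WhileFalse.prems show ?case by (rule exec_WhileE) (auto simp: WhileFalse.hyps)
next
  case (WhileTrue e s c t\<^sub>1 s\<^sub>1 t\<^sub>2 s\<^sub>2)
  from WhileTrue.prems show ?case by (rule exec_WhileE) (auto simp: WhileTrue.hyps dest!: WhileTrue.IH)
qed

text \<open>The input and the output are held in variable 0; all other variables start as
  \<^const>\<open>Leaf\<close>.\<close>

definition initial_store :: "tree \<Rightarrow> store" where
  "initial_store d = (\<lambda>_. Leaf)(0 := d)"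

text \<open>On every input \<open>x \<in> I\<close>, encoded as \<open>enc x\<close>, the program halts within time polynomial in the
  size of the encoding, with an output accepted by \<open>R x\<close>.\<close>

definition solves_in_poly_time :: "com \<Rightarrow> ('i \<Rightarrow> tree) \<Rightarrow> 'i set \<Rightarrow> ('i \<Rightarrow> tree \<Rightarrow> bool) \<Rightarrow> bool" where
  "solves_in_poly_time A enc I R \<longleftrightarrow>
    (\<exists>p :: nat poly. \<forall>x\<in>I. \<exists>t s.
      exec A (initial_store (enc x)) t s \<and> t \<le> poly p (tree_size (enc x)) \<and> R x (s 0))"


section \<open>Constraint satisfaction problems\<close>

text \<open>The domain \<open>[q]\<close> is \<open>{..<q}\<close>, and tuples are lists. Only the behaviour of \<open>holds P\<close> on
  \<open>[q]\<^sup>k\<close>, with \<open>k = arity P\<close>, is ever used.\<close>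

datatype predicate = Predicate (arity: nat) (holds: "nat list \<Rightarrow> bool")

record constraint =
  pred :: predicate
  scope :: "nat list"
  weight :: rat

record csp_instance =
  nvars :: nat
  constraints :: "constraint list"

text \<open>The variables of an instance \<open>F\<close> are the numbers below \<open>nvars F\<close>. Weights are rational, so
  that instances are finite inputs.\<close>

definition weighted_instances :: "predicate set \<Rightarrow> csp_instance set" where
  "weighted_instances \<Lambda> = {F.
    (\<forall>C \<in> set (constraints F).
      pred C \<in> \<Lambda> \<and> length (scope C) = arity (pred C) \<and>
      distinct (scope C) \<and> set (scope C) \<subseteq> {..<nvars F} \<and> weight C \<ge> 0) \<and>
    (\<Sum>C \<leftarrow> constraints F. weight C) = 1}"

definition unweighted :: "csp_instance \<Rightarrow> bool" where
  "unweighted F \<longleftrightarrow>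
    (\<forall>C \<in> set (constraints F). weight C = 1 / of_nat (length (constraints F)))"

definition degree_of :: "csp_instance \<Rightarrow> nat \<Rightarrow> nat" where
  "degree_of F x = length (filter (\<lambda>C. x \<in> set (scope C)) (constraints F))"

definition regular :: "csp_instance \<Rightarrow> bool" where
  "regular F \<longleftrightarrow> (\<exists>d. \<forall>x < nvars F. degree_of F x = d)"

definition unweighted_regular_instances :: "predicate set \<Rightarrow> csp_instance set" where
  "unweighted_regular_instances \<Lambda> = {F \<in> weighted_instances \<Lambda>. unweighted F \<and> regular F}"

text \<open>An assignment is the list of the values of the variables \<open>0, \<dots>, nvars F - 1\<close>.\<close>

definition assignments :: "nat \<Rightarrow> csp_instance \<Rightarrow> nat list set" where
  "assignments q F = {\<chi>. length \<chi> = nvars F \<and> set \<chi> \<subseteq> {..<q}}"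

definition Val :: "nat list \<Rightarrow> csp_instance \<Rightarrow> real" where
  "Val \<chi> F = (\<Sum>C \<leftarrow> constraints F.
    of_rat (weight C) * of_bool (holds (pred C) (map (\<lambda>x. \<chi> ! x) (scope C))))"

definition Opt :: "nat \<Rightarrow> csp_instance \<Rightarrow> real" where
  "Opt q F = Max ((\<lambda>\<chi>. Val \<chi> F) ` assignments q F)"


section \<open>Encodings and approximation algorithms\<close>

fun enc_unary :: "nat \<Rightarrow> tree" where
  "enc_unary 0 = Leaf"
| "enc_unary (Suc n) = Node Leaf (enc_unary n)"

text \<open>Least significant bit first.\<close>

fun enc_binary :: "nat \<Rightarrow> tree" where
  "enc_binary n =
    (if n = 0 then Leaf
     else Node (if odd n then Node Leaf Leaf else Leaf) (enc_binary (n div 2)))"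

declare enc_binary.simps [simp del]

definition enc_list :: "('a \<Rightarrow> tree) \<Rightarrow> 'a list \<Rightarrow> tree" where
  "enc_list f xs = foldr (\<lambda>x d. Node (f x) d) xs Leaf"

text \<open>Nonnegative rationals, in lowest terms.\<close>

definition enc_rat :: "rat \<Rightarrow> tree" where
  "enc_rat w = (case quotient_of w of (a, b) \<Rightarrow> Node (enc_binary (nat a)) (enc_binary (nat b)))"

text \<open>A predicate is given by the list of its satisfying tuples in \<open>[q]\<^sup>k\<close>, which has constant
  length for a fixed finite collection of predicates.\<close>

definition enc_predicate :: "nat \<Rightarrow> predicate \<Rightarrow> tree" where
  "enc_predicate q P =
    enc_list (enc_list enc_unary) (filter (holds P) (List.n_lists (arity P) [0..<q]))"

definition enc_constraint :: "nat \<Rightarrow> constraint \<Rightarrow> tree" where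
  "enc_constraint q C =
    Node (enc_predicate q (pred C)) (Node (enc_list enc_unary (scope C)) (enc_rat (weight C)))"

text \<open>The number of variables and the variables themselves are written in unary, since an instance
  lists its variables and an assignment has one entry for each of them; weights are in
  binary.\<close>

definition enc_instance :: "nat \<Rightarrow> csp_instance \<Rightarrow> tree" where
  "enc_instance q F = Node (enc_unary (nvars F)) (enc_list (enc_constraint q) (constraints F))"

definition enc_assignment :: "nat list \<Rightarrow> tree" where
  "enc_assignment \<chi> = enc_list enc_unary \<chi>"

definition approximation_algorithm :: "nat \<Rightarrow> csp_instance set \<Rightarrow> real \<Rightarrow> com \<Rightarrow> bool" where
  "approximation_algorithm q \<F> \<alpha> A \<longleftrightarrow>
    solves_in_poly_time A (enc_instance q) \<F>
      (\<lambda>F out. \<exists>\<chi> \<in> assignments q F. out = enc_assignment \<chi> \<and> Val \<chi> F \<ge> \<alpha> * Opt q F)"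

end

theory Submission
  imports Defs
begin

text \<open>
  Constraints with an unsatisfiable predicate or weight 0 are dropped. With \<open>w'\<close> the largest
  remaining weight, a constraint of weight \<open>w\<close> is repeated \<open>\<lfloor>M w / w'\<rfloor>\<close> times, where \<open>M\<close> is
  proportional to the number of constraints; since \<open>Opt \<ge> w'\<close>, the rounding costs only a small
  fraction of \<open>Opt\<close>.

  The resulting list of constraints, in which variable \<open>i\<close> has degree \<open>d\<^sub>i\<close>, is made regular by
  taking \<open>T\<close> copies of it (rounds) and splitting variable \<open>i\<close> into \<open>d\<^sub>i\<close> new variables, of which
  round \<open>t\<close> uses number \<open>t mod d\<^sub>i\<close>. Every new variable then has degree between \<open>T - d\<^sub>i\<close> and
  \<open>T + d\<^sub>i\<close>, and the total deficit does not depend on \<open>T\<close>. To remove it, everything is repeated on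
  \<open>K\<close> disjoint sets of variables, where \<open>K\<close> is the arity of a fixed predicate of \<open>\<Lambda>\<close>, and that
  predicate is applied to the \<open>K\<close> versions of a variable as often as needed. For large \<open>T\<close> this
  padding is negligible.

  An assignment of the new variables gives, for every round and every one of the \<open>K\<close> sets, an
  assignment of the original variables, and up to padding its value is the average of their
  values. No independence between rounds is needed, so the best of these polynomially many
  assignments is a solution.

  The algorithm is assembled from closure properties of polynomial-time functions, of which only
  the basic ones are proved by exhibiting a WHILE program.
\<close>

section \<open>Polynomial-time functions\<close>

text \<open>Copies of a variable may receive different values, and nothing forces them to agree.
  What makes this harmless is that within one round and one set a variable has exactly one copy. The
  price is that degrees become only nearly equal: if \<open>d\<^sub>i\<close> does not divide
  \<open>T\<close>, some copies are used once more often than others. \<open>\<Lambda>\<close> need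
  not contain a unary predicate to fill the gaps, and a predicate on \<open>K\<close> distinct
  variables raises \<open>K\<close> degrees at once; giving each copy \<open>K\<close> versions with
  the same deficit makes this an asset.

  The constants come from measuring every loss in units of \<open>w'\<close>. With \<open>m\<close>
  constraints, rounding costs at most \<open>m\<close> units and padding at most one, out of
  \<open>M\<close> units per \<open>w'\<close>. So \<open>M = (m + 1) * L\<close> with
  \<open>L \<ge> 1 / \<delta>\<close> loses at most \<open>\<delta> * Opt\<close>.

  An encoding shows a predicate only as a list of tuples. The algorithms are therefore specified on
  encoded data, and the regular instance behind an output is merely shown to exist.\<close>

text \<open>A total-correctness judgement with an upper bound on the time. Bounds add up along the
  program text, while the exact times of \<open>exec\<close> would depend on the run.\<close>

definition runs :: "com \<Rightarrow> store \<Rightarrow> nat \<Rightarrow> (store \<Rightarrow> bool) \<Rightarrow> bool" where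
  "runs c s b Q \<longleftrightarrow> (\<exists>t s'. exec c s t s' \<and> t \<le> b \<and> Q s')"

lemma runs_Assign: "Q (s(x := eval e s)) \<Longrightarrow> 1 + cost e s \<le> b \<Longrightarrow> runs (Assign x e) s b Q"
  unfolding runs_def using exec.Assign by blast

lemma runs_Seq:
  assumes "runs c s b Q" "\<And>s'. Q s' \<Longrightarrow> runs c' s' b' Q'"
  shows "runs (Seq c c') s (1 + b + b') Q'"
proof -
  obtain t s' where 1: "exec c s t s'" "t \<le> b" "Q s'" using assms(1) unfolding runs_def by blast
  obtain t' s'' where 2: "exec c' s' t' s''" "t' \<le> b'" "Q' s''"
    using assms(2)[OF 1(3)] unfolding runs_def by blast
  show ?thesis unfolding runs_def using exec.Seq[OF 1(1) 2(1)] 1 2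
    by (intro exI[of _ "1 + t + t'"] exI[of _ s'']) simp
qed

lemma runs_mono: "runs c s b Q \<Longrightarrow> b \<le> b' \<Longrightarrow> (\<And>s'. Q s' \<Longrightarrow> Q' s') \<Longrightarrow> runs c s b' Q'"
  unfolding runs_def by (meson order_trans)

lemma runs_Cond:
  assumes "eval e s \<noteq> Leaf \<Longrightarrow> runs c s b Q" "eval e s = Leaf \<Longrightarrow> runs c' s b Q"
  shows "runs (Cond e c c') s (1 + cost e s + b) Q"
proof (cases "eval e s = Leaf")
  case True
  then obtain t s' where "exec c' s t s'" "t \<le> b" "Q s'" using assms(2) unfolding runs_def by blast
  then show ?thesis unfolding runs_def using CondFalse[OF True, of c' t s' c] by fastforce
next
  case False
  then obtain t s' where "exec c s t s'" "t \<le> b" "Q s'" using assms(1) unfolding runs_def by blast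
  then show ?thesis unfolding runs_def using CondTrue[OF False, of c t s' c'] by fastforce
qed

lemma tree_size_eval_le_cost: "tree_size (eval e s) \<le> cost e s"
  by (cases e) auto

text \<open>Every computed value is charged its size, so a store cannot grow faster than time
  passes. Later this bounds the output of a polynomial-time program.\<close>

lemma tree_size_exec_le:
  "exec c s t s' \<Longrightarrow> tree_size (s' x) \<le> tree_size (s x) + t"
proof (induction rule: exec.induct)
  case (Assign y e s)
  then show ?case using tree_size_eval_le_cost[of e s] by auto
qed auto

section \<open>Relocating a program to higher variables\<close>

fun expr_bound :: "expr \<Rightarrow> nat" where
  "expr_bound (EVar x) = Suc x"
| "expr_bound ELeaf = 0"
| "expr_bound (ENode e f) = max (expr_bound e) (expr_bound f)"
| "expr_bound (ELeft e) = expr_bound e"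
| "expr_bound (ERight e) = expr_bound e"
| "expr_bound (EEq e f) = max (expr_bound e) (expr_bound f)"

fun com_bound :: "com \<Rightarrow> nat" where
  "com_bound Skip = 0"
| "com_bound (Assign x e) = max (Suc x) (expr_bound e)"
| "com_bound (Seq c d) = max (com_bound c) (com_bound d)"
| "com_bound (Cond e c d) = max (expr_bound e) (max (com_bound c) (com_bound d))"
| "com_bound (While e c) = max (expr_bound e) (com_bound c)"

fun shift_expr :: "nat \<Rightarrow> expr \<Rightarrow> expr" where
  "shift_expr k (EVar x) = EVar (x + k)"
| "shift_expr k ELeaf = ELeaf"
| "shift_expr k (ENode e f) = ENode (shift_expr k e) (shift_expr k f)"
| "shift_expr k (ELeft e) = ELeft (shift_expr k e)"
| "shift_expr k (ERight e) = ERight (shift_expr k e)"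
| "shift_expr k (EEq e f) = EEq (shift_expr k e) (shift_expr k f)"

fun shift_com :: "nat \<Rightarrow> com \<Rightarrow> com" where
  "shift_com k Skip = Skip"
| "shift_com k (Assign x e) = Assign (x + k) (shift_expr k e)"
| "shift_com k (Seq c d) = Seq (shift_com k c) (shift_com k d)"
| "shift_com k (Cond e c d) = Cond (shift_expr k e) (shift_com k c) (shift_com k d)"
| "shift_com k (While e c) = While (shift_expr k e) (shift_com k c)"

lemma shift_expr_eval:
  "expr_bound e \<le> N \<Longrightarrow> \<forall>x<N. s' (x + k) = s x \<Longrightarrow>
    eval (shift_expr k e) s' = eval e s \<and> cost (shift_expr k e) s' = cost e s"
  by (induction e) auto

text \<open>A lockstep simulation with equal times. Agreement of the stores is demanded only below a
  bound \<open>N\<close> on the variables the program mentions, since only finitely many variables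
  can be cleared beforehand.\<close>

lemma shift_com_exec:
  "exec c s t s' \<Longrightarrow> com_bound c \<le> N \<Longrightarrow> \<forall>x<N. u (x + k) = s x \<Longrightarrow>
    \<exists>u'. exec (shift_com k c) u t u' \<and> (\<forall>x<N. u' (x + k) = s' x) \<and> (\<forall>x<k. u' x = u x)"
proof (induction arbitrary: u rule: exec.induct)
  case (Skip s)
  then show ?case using exec.Skip[of u] by (intro exI[of _ u]) simp
next
  case (Assign x e s)
  have e: "eval (shift_expr k e) u = eval e s" "cost (shift_expr k e) u = cost e s"
    using shift_expr_eval[of e N u k s] Assign.prems by auto
  show ?case
    using exec.Assign[of "x + k" "shift_expr k e" u] Assign.prems e
    by (intro exI[of _ "u(x + k := eval e s)"]) (simp del: fun_upd_apply, simp)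
next
  case (Seq c1 s t1 s1 c2 t2 s2)
  obtain u1 where u1: "exec (shift_com k c1) u t1 u1" "\<forall>x<N. u1 (x + k) = s1 x" "\<forall>x<k. u1 x = u x"
    using Seq.IH(1)[of u] Seq.prems by auto
  obtain u2 where "exec (shift_com k c2) u1 t2 u2" "\<forall>x<N. u2 (x + k) = s2 x" "\<forall>x<k. u2 x = u1 x"
    using Seq.IH(2)[of u1] Seq.prems u1 by auto
  then show ?case using exec.Seq[OF u1(1)] u1(3) by (intro exI[of _ u2]) simp
next
  case (CondTrue e s c1 t s' c2)
  have e: "eval (shift_expr k e) u = eval e s" "cost (shift_expr k e) u = cost e s"
    using shift_expr_eval[of e N u k s] CondTrue.prems by auto
  obtain u1 where u1: "exec (shift_com k c1) u t u1" "\<forall>x<N. u1 (x + k) = s' x" "\<forall>x<k. u1 x = u x"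
    using CondTrue.IH[of u] CondTrue.prems by auto
  have "exec (shift_com k (Cond e c1 c2)) u (1 + cost e s + t) u1"
    using exec.CondTrue[OF _ u1(1), of "shift_expr k e"] e CondTrue.hyps(1) by simp
  then show ?case using u1 by blast
next
  case (CondFalse e s c2 t s' c1)
  have e: "eval (shift_expr k e) u = eval e s" "cost (shift_expr k e) u = cost e s"
    using shift_expr_eval[of e N u k s] CondFalse.prems by auto
  obtain u1 where u1: "exec (shift_com k c2) u t u1" "\<forall>x<N. u1 (x + k) = s' x" "\<forall>x<k. u1 x = u x"
    using CondFalse.IH[of u] CondFalse.prems by auto
  have "exec (shift_com k (Cond e c1 c2)) u (1 + cost e s + t) u1"
    using exec.CondFalse[OF _ u1(1), of "shift_expr k e"] e CondFalse.hyps(1) by simp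
  then show ?case using u1 by blast
next
  case (WhileFalse e s c)
  have e: "eval (shift_expr k e) u = eval e s" "cost (shift_expr k e) u = cost e s"
    using shift_expr_eval[of e N u k s] WhileFalse.prems by auto
  then show ?case using WhileFalse exec.WhileFalse[of "shift_expr k e" u "shift_com k c"]
    by (intro exI[of _ u]) simp
next
  case (WhileTrue e s c t1 s1 t2 s2)
  have e: "eval (shift_expr k e) u = eval e s" "cost (shift_expr k e) u = cost e s"
    using shift_expr_eval[of e N u k s] WhileTrue.prems by auto
  obtain u1 where u1: "exec (shift_com k c) u t1 u1" "\<forall>x<N. u1 (x + k) = s1 x" "\<forall>x<k. u1 x = u x"
    using WhileTrue.IH(1)[of u] WhileTrue.prems by auto
  obtain u2 where "exec (shift_com k (While e c)) u1 t2 u2" "\<forall>x<N. u2 (x + k) = s2 x" "\<forall>x<k. u2 x = u1 x"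
    using WhileTrue.IH(2)[of u1] WhileTrue.prems u1 by auto
  then show ?case using exec.WhileTrue[of "shift_expr k e" u "shift_com k c" t1 u1 t2 u2] u1 e WhileTrue.hyps(1)
    by (intro exI[of _ u2]) simp
qed

text \<open>A relocated program expects \<open>Leaf\<close> in its other variables. Variable
  \<open>k\<close> is spared because it holds the input.\<close>

primrec clear_vars :: "nat \<Rightarrow> nat \<Rightarrow> com" where
  "clear_vars k 0 = Skip"
| "clear_vars k (Suc n) = Seq (clear_vars k n) (Assign (k + Suc n) ELeaf)"

lemma runs_clear_vars:
  "runs (clear_vars k n) s (1 + 3 * n) (\<lambda>s'. \<forall>x. s' x = (if k < x \<and> x \<le> k + n then Leaf else s x))"
proof (induction n)
  case 0
  show ?case unfolding runs_def using exec.Skip[of s] by (intro exI[of _ 1] exI[of _ s]) auto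
next
  case (Suc n)
  show ?case unfolding clear_vars.simps
    by (rule runs_mono[OF runs_Seq[OF Suc, where b'=2]])
       (auto intro!: runs_Assign)
qed

section \<open>Polynomial bounds and closure properties\<close>

definition pbounded :: "'a set \<Rightarrow> ('a \<Rightarrow> tree) \<Rightarrow> ('a \<Rightarrow> nat) \<Rightarrow> bool" where
  "pbounded S E T \<longleftrightarrow> (\<exists>p :: nat poly. \<forall>x\<in>S. T x \<le> poly p (tree_size (E x)))"

lemma poly_nat_mono: "a \<le> b \<Longrightarrow> poly (p :: nat poly) a \<le> poly p b"
  by (induction p) (auto intro: add_mono mult_mono)

lemma pbounded_const: "pbounded S E (\<lambda>_. c)"
  unfolding pbounded_def by (rule exI[of _ "[:c:]"]) simp

lemma pbounded_size: "pbounded S E (\<lambda>x. tree_size (E x))"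
  unfolding pbounded_def by (rule exI[of _ "[:0, 1:]"]) simp

lemma pbounded_add: "pbounded S E f \<Longrightarrow> pbounded S E g \<Longrightarrow> pbounded S E (\<lambda>x. f x + g x)"
  unfolding pbounded_def by (metis add_mono poly_add)

lemma pbounded_mult: "pbounded S E f \<Longrightarrow> pbounded S E g \<Longrightarrow> pbounded S E (\<lambda>x. f x * g x)"
  unfolding pbounded_def by (metis mult_le_mono poly_mult)

lemma pbounded_Suc: "pbounded S E f \<Longrightarrow> pbounded S E (\<lambda>x. Suc (f x))"
  using pbounded_add[OF pbounded_const[of S E 1], of f] by simp

lemma pbounded_mono: "pbounded S E f \<Longrightarrow> (\<And>x. x \<in> S \<Longrightarrow> g x \<le> f x) \<Longrightarrow> pbounded S E g"
  unfolding pbounded_def by (meson order_trans)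

lemma pbounded_poly: "pbounded S E f \<Longrightarrow> pbounded S E (\<lambda>x. poly p (f x))"
proof -
  assume "pbounded S E f"
  then obtain r where "\<forall>x\<in>S. f x \<le> poly r (tree_size (E x))" unfolding pbounded_def by blast
  then show ?thesis unfolding pbounded_def
    by (intro exI[of _ "pcompose p r"]) (auto simp: poly_pcompose intro: poly_nat_mono)
qed

lemmas pbounded_intros = pbounded_const pbounded_size pbounded_add pbounded_mult pbounded_Suc

text \<open>Inputs are abstract objects seen through the encoding \<open>E\<close>, and only those
  in \<open>S\<close> matter. This restriction lets the given algorithm be treated as such a
  function, although nothing is known about it outside the regular instances.\<close>

definition ptime_on :: "'a set \<Rightarrow> ('a \<Rightarrow> tree) \<Rightarrow> ('a \<Rightarrow> tree) \<Rightarrow> bool" where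
  "ptime_on S E f \<longleftrightarrow> (\<exists>A. solves_in_poly_time A E S (\<lambda>x out. out = f x))"

text \<open>A program that may be run inside a larger one: it works on variable \<open>k\<close>, whatever the other
  variables contain, and leaves the variables below \<open>k\<close> alone.\<close>

definition computes_at :: "nat \<Rightarrow> com \<Rightarrow> 'a set \<Rightarrow> ('a \<Rightarrow> tree) \<Rightarrow> ('a \<Rightarrow> tree) \<Rightarrow> ('a \<Rightarrow> nat) \<Rightarrow> bool" where
  "computes_at k c S E f T \<longleftrightarrow>
    (\<forall>x\<in>S. \<forall>s. s k = E x \<longrightarrow> runs c s (T x) (\<lambda>s'. s' k = f x \<and> (\<forall>y<k. s' y = s y)))"

lemma computes_atD:
  "computes_at k c S E f T \<Longrightarrow> x \<in> S \<Longrightarrow> s k = E x \<Longrightarrow>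
    runs c s (T x) (\<lambda>s'. s' k = f x \<and> (\<forall>y<k. s' y = s y))"
  unfolding computes_at_def by blast

lemma ptime_onI:
  assumes "computes_at 0 c S E f T" "pbounded S E T"
  shows "ptime_on S E f"
proof -
  obtain p where p: "\<forall>x\<in>S. T x \<le> poly p (tree_size (E x))" using assms(2) unfolding pbounded_def by blast
  show ?thesis unfolding ptime_on_def solves_in_poly_time_def
  proof (intro exI[of _ c] exI[of _ p] ballI)
    fix x assume "x \<in> S"
    then have "runs c (initial_store (E x)) (T x) (\<lambda>s'. s' 0 = f x)"
      by (rule runs_mono[OF computes_atD[OF assms(1)]]) (auto simp: initial_store_def)
    then show "\<exists>t s. exec c (initial_store (E x)) t s \<and> t \<le> poly p (tree_size (E x)) \<and> s 0 = f x"
      using p \<open>x \<in> S\<close> unfolding runs_def by (meson order_trans)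
  qed
qed

text \<open>A program specified only on initial stores becomes a subprogram at any \<open>k\<close>:
  clear the variables it may read, then run it shifted by \<open>k\<close>. This is how programs are
  plugged together below.\<close>

lemma ptime_onD:
  assumes "ptime_on S E f"
  obtains c T where "computes_at k c S E f T" "pbounded S E T"
proof -
  obtain A p where A: "\<forall>x\<in>S. \<exists>t s. exec A (initial_store (E x)) t s \<and> t \<le> poly p (tree_size (E x)) \<and> s 0 = f x"
    using assms unfolding ptime_on_def solves_in_poly_time_def by blast
  \<comment> \<open>\<open>Suc\<close> keeps variable 0, which carries input and output, below the
    bound even if \<open>A\<close> mentions no variable.\<close>
  define N where "N = Suc (com_bound A)"
  let ?c = "Seq (clear_vars k N) (shift_com k A)"
  let ?T = "\<lambda>x. 1 + (1 + 3 * N) + poly p (tree_size (E x))"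
  have "computes_at k ?c S E f ?T"
    unfolding computes_at_def
  proof (intro ballI allI impI)
    fix x and s :: store assume x: "x \<in> S" and s: "s k = E x"
    obtain t u where u: "exec A (initial_store (E x)) t u" "t \<le> poly p (tree_size (E x))" "u 0 = f x"
      using A x by blast
    show "runs ?c s (?T x) (\<lambda>s'. s' k = f x \<and> (\<forall>y<k. s' y = s y))"
    proof (rule runs_Seq[OF runs_clear_vars])
      fix s' assume s': "\<forall>x. s' x = (if k < x \<and> x \<le> k + N then Leaf else s x)"
      have "\<forall>y<N. s' (y + k) = initial_store (E x) y"
        using s' s by (auto simp: initial_store_def)
      then obtain u' where u': "exec (shift_com k A) s' t u'" "\<forall>x<N. u' (x + k) = u x" "\<forall>x<k. u' x = s' x"
        using shift_com_exec[OF u(1), of N s' k] by (auto simp: N_def)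
      have "u' k = f x" using u'(2)[rule_format, of 0] u by (simp add: N_def)
      then show "runs (shift_com k A) s' (poly p (tree_size (E x))) (\<lambda>s'. s' k = f x \<and> (\<forall>y<k. s' y = s y))"
        unfolding runs_def using u' u s' by (intro exI[of _ t] exI[of _ u']) auto
    qed
  qed
  moreover have "pbounded S E ?T"
    by (intro pbounded_intros pbounded_poly)
  ultimately show ?thesis using that by blast
qed

text \<open>The output is at most as large as the input plus the running time. Composition rests on
  this, since the second program is timed on the output of the first.\<close>

lemma ptime_on_size:
  assumes "ptime_on S E f"
  shows "pbounded S E (\<lambda>x. tree_size (f x))"
proof -
  obtain A p where A: "\<forall>x\<in>S. \<exists>t s. exec A (initial_store (E x)) t s \<and> t \<le> poly p (tree_size (E x)) \<and> s 0 = f x"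
    using assms unfolding ptime_on_def solves_in_poly_time_def by blast
  have "tree_size (f x) \<le> tree_size (E x) + poly p (tree_size (E x))" if x: "x \<in> S" for x
  proof -
    obtain t s where ts: "exec A (initial_store (E x)) t s" "t \<le> poly p (tree_size (E x))" "s 0 = f x"
      using A x by blast
    show ?thesis using tree_size_exec_le[OF ts(1), of 0] ts(2,3) by (simp add: initial_store_def)
  qed
  moreover have "pbounded S E (\<lambda>x. tree_size (E x) + poly p (tree_size (E x)))"
    by (intro pbounded_intros pbounded_poly)
  ultimately show ?thesis by (rule pbounded_mono[rotated])
qed

lemma ptime_on_id: "ptime_on S E E"
proof (rule ptime_onI)
  show "computes_at 0 Skip S E E (\<lambda>_. 1)"
    unfolding computes_at_def runs_def using exec.Skip by fastforce
qed (rule pbounded_const)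

lemma ptime_on_Leaf: "ptime_on S E (\<lambda>_. Leaf)"
proof (rule ptime_onI)
  show "computes_at 0 (Assign 0 ELeaf) S E (\<lambda>_. Leaf) (\<lambda>_. 2)"
    unfolding computes_at_def by (auto intro!: runs_Assign)
qed (rule pbounded_const)

lemma ptime_on_comp:
  assumes "ptime_on S' E' g" "ptime_on S E (\<lambda>x. E' (h x))" "h ` S \<subseteq> S'"
  shows "ptime_on S E (\<lambda>x. g (h x))"
proof -
  obtain c1 T1 where 1: "computes_at 0 c1 S E (\<lambda>x. E' (h x)) T1" "pbounded S E T1"
    using ptime_onD[OF assms(2)] .
  obtain c2 T2 where 2: "computes_at 0 c2 S' E' g T2" "pbounded S' E' T2"
    using ptime_onD[OF assms(1)] .
  show ?thesis
  proof (rule ptime_onI)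
    show "computes_at 0 (Seq c1 c2) S E (\<lambda>x. g (h x)) (\<lambda>x. 1 + T1 x + T2 (h x))"
      unfolding computes_at_def
    proof (intro ballI allI impI)
      fix x and s :: store assume x: "x \<in> S" and s: "s 0 = E x"
      show "runs (Seq c1 c2) s (1 + T1 x + T2 (h x)) (\<lambda>s'. s' 0 = g (h x) \<and> (\<forall>y<0. s' y = s y))"
        using computes_atD[OF 2(1), of "h x"] assms(3) x
        by (intro runs_Seq[OF computes_atD[where s=s, OF 1(1) x s]]) auto
    qed
    obtain p where p: "\<forall>x\<in>S'. T2 x \<le> poly p (tree_size (E' x))"
      using 2(2) unfolding pbounded_def by blast
    have "pbounded S E (\<lambda>x. T2 (h x))"
      by (rule pbounded_mono[OF pbounded_poly[OF ptime_on_size[OF assms(2)], of p]])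
         (use p assms(3) in auto)
    then show "pbounded S E (\<lambda>x. 1 + T1 x + T2 (h x))"
      by (intro pbounded_intros 1)
  qed
qed

text \<open>Two subprograms run on separate copies of the input, followed by one expression that
  combines the results.\<close>

lemma ptime_on_binary:
  assumes f: "ptime_on S E f" and g: "ptime_on S E g"
    and e: "\<And>s. eval e s = op (s 1) (s 2)"
    and c: "\<And>s. cost e s \<le> 10 + 3 * tree_size (s 1) + 3 * tree_size (s 2)"
  shows "ptime_on S E (\<lambda>x. op (f x) (g x))"
proof -
  obtain c1 T1 where 1: "computes_at 1 c1 S E f T1" "pbounded S E T1"
    using ptime_onD[OF f] .
  obtain c2 T2 where 2: "computes_at 2 c2 S E g T2" "pbounded S E T2"
    using ptime_onD[OF g] .
  let ?T = "\<lambda>x. 1 + (1 + tree_size (E x)) + (1 + T1 x + (1 + (1 + tree_size (E x)) + (1 + T2 x +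
    (1 + (10 + 3 * tree_size (f x) + 3 * tree_size (g x))))))"
  show ?thesis
  proof (rule ptime_onI)
    show "computes_at 0 (Seq (Assign 1 (EVar 0)) (Seq c1 (Seq (Assign 2 (EVar 0)) (Seq c2
        (Assign 0 e))))) S E (\<lambda>x. op (f x) (g x)) ?T"
      (is "computes_at 0 ?c S E _ _")
      unfolding computes_at_def
    proof (intro ballI allI impI)
      fix x and s0 :: store assume x: "x \<in> S" and s: "s0 0 = E x"
      let ?Q1 = "\<lambda>s. s 0 = E x \<and> s 1 = E x"
      let ?Q2 = "\<lambda>s. s 0 = E x \<and> s 1 = f x"
      let ?Q3 = "\<lambda>s. s 0 = E x \<and> s 1 = f x \<and> s 2 = E x"
      let ?Q4 = "\<lambda>s. s 1 = f x \<and> s 2 = g x"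
      show "runs ?c s0 (?T x) (\<lambda>s'. s' 0 = op (f x) (g x) \<and> (\<forall>y<0. s' y = s0 y))"
      proof (rule runs_Seq[where Q="?Q1"])
        show "runs (Assign 1 (EVar 0)) s0 (1 + tree_size (E x)) ?Q1"
          by (rule runs_Assign) (use s in auto)
      next
        fix s :: store assume s: "?Q1 s"
        show "runs (Seq c1 (Seq (Assign 2 (EVar 0)) (Seq c2 (Assign 0 e)))) s
          (1 + T1 x + (1 + (1 + tree_size (E x)) + (1 + T2 x +
            (1 + (10 + 3 * tree_size (f x) + 3 * tree_size (g x))))))
          (\<lambda>s'. s' 0 = op (f x) (g x) \<and> (\<forall>y<0. s' y = s0 y))"
        proof (rule runs_Seq[where Q="?Q2"])
          show "runs c1 s (T1 x) ?Q2"
            by (rule runs_mono[OF computes_atD[OF 1(1) x]]) (use s in auto)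
        next
          fix s :: store assume s: "?Q2 s"
          show "runs (Seq (Assign 2 (EVar 0)) (Seq c2 (Assign 0 e))) s
            (1 + (1 + tree_size (E x)) + (1 + T2 x +
              (1 + (10 + 3 * tree_size (f x) + 3 * tree_size (g x)))))
            (\<lambda>s'. s' 0 = op (f x) (g x) \<and> (\<forall>y<0. s' y = s0 y))"
          proof (rule runs_Seq[where Q="?Q3"])
            show "runs (Assign 2 (EVar 0)) s (1 + tree_size (E x)) ?Q3"
              by (rule runs_Assign) (use s in auto)
          next
            fix s :: store assume s: "?Q3 s"
            show "runs (Seq c2 (Assign 0 e)) s
              (1 + T2 x + (1 + (10 + 3 * tree_size (f x) + 3 * tree_size (g x))))
              (\<lambda>s'. s' 0 = op (f x) (g x) \<and> (\<forall>y<0. s' y = s0 y))"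
            proof (rule runs_Seq[where Q="?Q4"])
              show "runs c2 s (T2 x) ?Q4"
                by (rule runs_mono[OF computes_atD[OF 2(1) x]]) (use s in auto)
            next
              fix s :: store assume s: "?Q4 s"
              show "runs (Assign 0 e) s (1 + (10 + 3 * tree_size (f x) + 3 * tree_size (g x)))
                (\<lambda>s'. s' 0 = op (f x) (g x) \<and> (\<forall>y<0. s' y = s0 y))"
                by (rule runs_Assign)
                  (use s e[of s] c[of s] in auto)
            qed
          qed
        qed
      qed
    qed
    show "pbounded S E ?T"
      by (intro pbounded_intros ptime_on_size[OF f] ptime_on_size[OF g] 1 2)
  qed
qed

lemma ptime_on_Node:
  "ptime_on S E f \<Longrightarrow> ptime_on S E g \<Longrightarrow> ptime_on S E (\<lambda>x. Node (f x) (g x))"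
  by (rule ptime_on_binary[where e="ENode (EVar 1) (EVar 2)" and op=Node]) auto

lemma ptime_on_eq:
  "ptime_on S E f \<Longrightarrow> ptime_on S E g \<Longrightarrow>
    ptime_on S E (\<lambda>x. if f x = g x then Node Leaf Leaf else Leaf)"
  by (rule ptime_on_binary[where e="EEq (EVar 1) (EVar 2)" and op="\<lambda>a b. if a = b then Node Leaf Leaf else Leaf"]) auto

lemma tree_size_left: "tree_size (left d) \<le> tree_size d"
  by (cases d) auto

lemma tree_size_right: "tree_size (right d) \<le> tree_size d"
  by (cases d) auto

lemma ptime_on_left: "ptime_on S E f \<Longrightarrow> ptime_on S E (\<lambda>x. left (f x))"
  by (rule ptime_on_binary[where e="ELeft (EVar 1)" and g=f and op="\<lambda>d _. left d"])
     (use tree_size_left in \<open>auto intro: trans_le_add1 order_trans[OF tree_size_left]\<close>)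

lemma ptime_on_right: "ptime_on S E f \<Longrightarrow> ptime_on S E (\<lambda>x. right (f x))"
  by (rule ptime_on_binary[where e="ERight (EVar 1)" and g=f and op="\<lambda>d _. right d"])
     (use tree_size_right in \<open>auto intro: trans_le_add1 order_trans[OF tree_size_right]\<close>)

lemma ptime_on_const: "ptime_on S E (\<lambda>_. d)"
  by (induction d) (auto intro: ptime_on_Leaf ptime_on_Node)

text \<open>The test is computed on a copy of the input in variable 1, so that either branch still
  finds the input in variable 0.\<close>

lemma ptime_on_if:
  assumes f: "ptime_on S E f" and g: "ptime_on S E g" and h: "ptime_on S E h"
  shows "ptime_on S E (\<lambda>x. if f x \<noteq> Leaf then g x else h x)"
proof -
  obtain c1 T1 where 1: "computes_at 1 c1 S E f T1" "pbounded S E T1"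
    using ptime_onD[OF f] .
  obtain c2 T2 where 2: "computes_at 0 c2 S E g T2" "pbounded S E T2"
    using ptime_onD[OF g] .
  obtain c3 T3 where 3: "computes_at 0 c3 S E h T3" "pbounded S E T3"
    using ptime_onD[OF h] .
  let ?T = "\<lambda>x. 1 + (1 + tree_size (E x)) + (1 + T1 x + (1 + tree_size (f x) + (T2 x + T3 x)))"
  show ?thesis
  proof (rule ptime_onI)
    show "computes_at 0 (Seq (Assign 1 (EVar 0)) (Seq c1 (Cond (EVar 1) c2 c3))) S E
        (\<lambda>x. if f x \<noteq> Leaf then g x else h x) ?T"
      (is "computes_at 0 ?c S E ?f _")
      unfolding computes_at_def
    proof (intro ballI allI impI)
      fix x and s0 :: store assume x: "x \<in> S" and s: "s0 0 = E x"
      let ?Q1 = "\<lambda>s. s 0 = E x \<and> s 1 = E x"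
      let ?Q2 = "\<lambda>s. s 0 = E x \<and> s 1 = f x"
      show "runs ?c s0 (?T x) (\<lambda>s'. s' 0 = ?f x \<and> (\<forall>y<0. s' y = s0 y))"
      proof (rule runs_Seq[where Q="?Q1"])
        show "runs (Assign 1 (EVar 0)) s0 (1 + tree_size (E x)) ?Q1"
          by (rule runs_Assign) (use s in auto)
      next
        fix s :: store assume s: "?Q1 s"
        show "runs (Seq c1 (Cond (EVar 1) c2 c3)) s (1 + T1 x + (1 + tree_size (f x) + (T2 x + T3 x)))
          (\<lambda>s'. s' 0 = ?f x \<and> (\<forall>y<0. s' y = s0 y))"
        proof (rule runs_Seq[where Q="?Q2"])
          show "runs c1 s (T1 x) ?Q2"
            by (rule runs_mono[OF computes_atD[OF 1(1) x]]) (use s in auto)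
        next
          fix s :: store assume s: "?Q2 s"
          have "runs (Cond (EVar 1) c2 c3) s (1 + cost (EVar 1) s + (T2 x + T3 x)) (\<lambda>s'. s' 0 = ?f x)"
            by (rule runs_Cond)
               (use s in \<open>auto intro: runs_mono[OF computes_atD[OF 2(1) x]]
                 runs_mono[OF computes_atD[OF 3(1) x]]\<close>)
          then show "runs (Cond (EVar 1) c2 c3) s (1 + tree_size (f x) + (T2 x + T3 x))
            (\<lambda>s'. s' 0 = ?f x \<and> (\<forall>y<0. s' y = s0 y))"
            using s by simp
        qed
      qed
    qed
    show "pbounded S E ?T"
      by (intro pbounded_intros ptime_on_size[OF f] 1 2 3)
  qed
qed

definition enc_pair :: "('a \<Rightarrow> tree) \<Rightarrow> ('b \<Rightarrow> tree) \<Rightarrow> 'a \<times> 'b \<Rightarrow> tree" where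
  "enc_pair e f p = Node (e (fst p)) (f (snd p))"

lemma enc_list_simps [simp]:
  "enc_list e [] = Leaf" "enc_list e (x # xs) = Node (e x) (enc_list e xs)"
  by (simp_all add: enc_list_def)

abbreviation ptime :: "('a \<Rightarrow> tree) \<Rightarrow> ('a \<Rightarrow> tree) \<Rightarrow> bool" where
  "ptime \<equiv> ptime_on UNIV"

lemma ptime_on_cong: "ptime_on S E f \<Longrightarrow> (\<And>x. x \<in> S \<Longrightarrow> f x = g x) \<Longrightarrow> ptime_on S E g"
  unfolding ptime_on_def solves_in_poly_time_def by fastforce

lemma ptime_comp: "ptime e g \<Longrightarrow> ptime E (\<lambda>z. e (f z)) \<Longrightarrow> ptime E (\<lambda>z. g (f z))"
  by (rule ptime_on_comp) auto

lemma ptime_pair: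
  "ptime E (\<lambda>z. e (f z)) \<Longrightarrow> ptime E (\<lambda>z. e' (g z)) \<Longrightarrow> ptime E (\<lambda>z. enc_pair e e' (f z, g z))"
  by (simp add: enc_pair_def ptime_on_Node)

text \<open>Once a binary function has been handled on pairs, this allows arbitrary polynomial-time
  expressions as its arguments.\<close>

lemma ptime_comp2:
  assumes "ptime (enc_pair e e') (\<lambda>p. g (fst p) (snd p))"
    and "ptime E (\<lambda>z. e (f z))" "ptime E (\<lambda>z. e' (f' z))"
  shows "ptime E (\<lambda>z. g (f z) (f' z))"
  using ptime_comp[OF assms(1) ptime_pair[of E e f e' f', OF assms(2,3)]] by simp

lemma ptime_fst: "ptime E (\<lambda>z. enc_pair e e' (f z)) \<Longrightarrow> ptime E (\<lambda>z. e (fst (f z)))"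
  using ptime_on_left[of UNIV E "\<lambda>z. enc_pair e e' (f z)"] by (simp add: enc_pair_def)

lemma ptime_snd: "ptime E (\<lambda>z. enc_pair e e' (f z)) \<Longrightarrow> ptime E (\<lambda>z. e' (snd (f z)))"
  using ptime_on_right[of UNIV E "\<lambda>z. enc_pair e e' (f z)"] by (simp add: enc_pair_def)

section \<open>Loops over lists\<close>

lemma runs_While_step:
  assumes "eval e s \<noteq> Leaf" "runs c s b Q" "\<And>s'. Q s' \<Longrightarrow> runs (While e c) s' b' Q'"
  shows "runs (While e c) s (1 + cost e s + b + b') Q'"
proof -
  obtain t s' where 1: "exec c s t s'" "t \<le> b" "Q s'" using assms(2) unfolding runs_def by blast
  obtain t' s'' where 2: "exec (While e c) s' t' s''" "t' \<le> b'" "Q' s''"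
    using assms(3)[OF 1(3)] unfolding runs_def by blast
  show ?thesis unfolding runs_def using exec.WhileTrue[OF assms(1) 1(1) 2(1)] 1 2
    by (intro exI[of _ "1 + cost e s + t + t'"] exI[of _ s'']) simp
qed

lemma runs_While_end:
  assumes "eval e s = Leaf" "Q s" "1 + cost e s \<le> b"
  shows "runs (While e c) s b Q"
  unfolding runs_def using exec.WhileFalse[OF assms(1), of c] assms(2,3) by blast

lemma tree_size_enc_list_append:
  "tree_size (enc_list e (xs @ ys)) + 1 = tree_size (enc_list e xs) + tree_size (enc_list e ys)"
  by (induction xs) auto

lemma tree_size_pos [simp]: "0 < tree_size d"
  by (cases d) auto

text \<open>The loop state is the triple of the remaining list, the environment and the accumulator.\<close>

lemma ptime_fold:
  assumes xs: "ptime E (\<lambda>z. enc_list ex (xs z))"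
    and a: "ptime E (\<lambda>z. ey (a z))"
    and h: "ptime (enc_pair E (enc_pair ex ey)) (\<lambda>p. ey (h (fst p) (fst (snd p)) (snd (snd p))))"
    and b: "pbounded UNIV E b"
    and size: "\<And>z ys zs. xs z = ys @ zs \<Longrightarrow> tree_size (ey (fold (h z) ys (a z))) \<le> b z"
  shows "ptime E (\<lambda>z. ey (fold (h z) (xs z) (a z)))"
proof -
  define e where "e = enc_pair (enc_list ex) (enc_pair E ey)"
  \<comment> \<open>The loop test fails on the empty list, so a step has to be correct only on
    nonempty lists, where \<open>hd\<close> and \<open>tl\<close> are the two parts of the
    encoding.\<close>
  define S where "S = {p :: 'b list \<times> 'a \<times> 'c. fst p \<noteq> []}"
  define st where "st p = (tl (fst p), fst (snd p), h (fst (snd p)) (hd (fst p)) (snd (snd p)))"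
    for p :: "'b list \<times> 'a \<times> 'c"
  have init: "ptime E (\<lambda>z. e (xs z, z, a z))"
    unfolding e_def by (intro ptime_pair xs a ptime_on_id)
  have "ptime_on S e (\<lambda>p. Node (right (left (e p))) (Node (left (right (e p)))
      (ey (h (fst (snd p)) (hd (fst p)) (snd (snd p))))))"
  proof (intro ptime_on_Node ptime_on_left ptime_on_right ptime_on_id)
    have "ptime_on S e (\<lambda>p. Node (left (right (e p))) (Node (left (left (e p))) (right (right (e p)))))"
      by (intro ptime_on_Node ptime_on_left ptime_on_right ptime_on_id)
    then have "ptime_on S e (\<lambda>p. enc_pair E (enc_pair ex ey) (fst (snd p), hd (fst p), snd (snd p)))"
      by (rule ptime_on_cong) (auto simp: S_def e_def enc_pair_def neq_Nil_conv)
    from ptime_on_comp[OF h this]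
    show "ptime_on S e (\<lambda>p. ey (h (fst (snd p)) (hd (fst p)) (snd (snd p))))" by simp
  qed
  then have step: "ptime_on S e (\<lambda>p. e (st p))"
    by (rule ptime_on_cong) (auto simp: S_def e_def st_def enc_pair_def neq_Nil_conv)
  obtain c T where c: "computes_at 0 c S e (\<lambda>p. e (st p)) T" "pbounded S e T"
    using ptime_onD[OF step] .
  obtain p where p: "\<And>y. y \<in> S \<Longrightarrow> T y \<le> poly p (tree_size (e y))"
    using c(2) unfolding pbounded_def by blast
  obtain c0 T0 where c0: "computes_at 0 c0 UNIV E (\<lambda>z. e (xs z, z, a z)) T0" "pbounded UNIV E T0"
    using ptime_onD[OF init] .
  define X where "X z = tree_size (enc_list ex (xs z))" for z
  \<comment> \<open>\<open>L\<close> bounds the encoded loop state, with 2 for its two pairing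
    nodes, and \<open>I\<close> bounds one iteration including the test. \<open>L\<close> is
    polynomial because \<open>b\<close> bounds all intermediate accumulators.\<close>
  define L where "L z = 2 + X z + tree_size (E z) + b z" for z
  define I where "I z = 1 + (L z + L z) + poly p (L z)" for z
  let ?w = "While (ELeft (EVar 0)) c"
  have len: "length l \<le> tree_size (enc_list ex l)" for l by (induction l) auto
  have loop: "xs z = ys @ l \<Longrightarrow> s 0 = e (l, z, fold (h z) ys (a z)) \<Longrightarrow>
      runs ?w s (length l * I z + (1 + (L z + L z))) (\<lambda>s'. s' 0 = e ([], z, fold (h z) (xs z) (a z)))"
    for s :: store and z ys l
  proof (induction l arbitrary: s ys)
    case Nil
    have "tree_size (ey (fold (h z) ys (a z))) \<le> b z" using size[of z ys "[]"] Nil by simp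
    then show ?case using Nil
      by (intro runs_While_end) (auto simp: e_def enc_pair_def L_def)
  next
    case (Cons x l)
    let ?y = "fold (h z) ys (a z)"
    let ?p = "(x # l, z, ?y)"
    have "tree_size (ey ?y) \<le> b z" using size[of z ys "x # l"] Cons.prems by simp
    moreover have "tree_size (enc_list ex (x # l)) \<le> X z"
      using tree_size_enc_list_append[of ex ys "x # l"] Cons.prems tree_size_pos[of "enc_list ex ys"]
      unfolding X_def by (simp del: tree_size_pos)
    ultimately have L: "tree_size (e ?p) \<le> L z" by (simp add: e_def enc_pair_def L_def)
    have pS: "?p \<in> S" by (simp add: S_def)
    have T: "T ?p \<le> poly p (L z)" using p[OF pS] poly_nat_mono[OF L, of p] by linarith
    have cost: "cost (ELeft (EVar 0)) s \<le> L z + L z"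
      using L Cons.prems(2) by (simp add: e_def enc_pair_def)
    have "runs ?w s (1 + cost (ELeft (EVar 0)) s + T ?p + (length l * I z + (1 + (L z + L z))))
        (\<lambda>s'. s' 0 = e ([], z, fold (h z) (xs z) (a z)))"
    proof (rule runs_While_step)
      show "eval (ELeft (EVar 0)) s \<noteq> Leaf" using Cons.prems by (simp add: e_def enc_pair_def)
      show "runs c s (T ?p) (\<lambda>s'. s' 0 = e (st ?p) \<and> (\<forall>y<0. s' y = s y))"
        by (rule computes_atD[OF c(1) pS]) (rule Cons.prems)
      fix s' assume "s' 0 = e (st ?p) \<and> (\<forall>y<0. s' y = s y)"
      then show "runs ?w s' (length l * I z + (1 + (L z + L z)))
          (\<lambda>s'. s' 0 = e ([], z, fold (h z) (xs z) (a z)))"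
        using Cons.IH[of "ys @ [x]" s'] Cons.prems by (simp add: st_def)
    qed
    then show ?case
      by (rule runs_mono) (use cost T in \<open>simp_all add: I_def\<close>)
  qed
  let ?f = "\<lambda>z. e ([], z, fold (h z) (xs z) (a z))"
  have X: "pbounded UNIV E X" unfolding X_def by (rule ptime_on_size[OF xs])
  have "ptime E ?f"
  proof (rule ptime_onI)
    show "computes_at 0 (Seq c0 ?w) UNIV E ?f (\<lambda>z. 1 + T0 z + (X z * I z + (1 + (L z + L z))))"
      unfolding computes_at_def
    proof (intro ballI allI impI)
      fix z and s :: store assume "s 0 = E z"
      then show "runs (Seq c0 ?w) s (1 + T0 z + (X z * I z + (1 + (L z + L z))))
          (\<lambda>s'. s' 0 = ?f z \<and> (\<forall>y<0. s' y = s y))"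
        by (intro runs_Seq[OF computes_atD[OF c0(1)]])
           (auto intro!: runs_mono[OF loop[of _ "[]" "xs z"]] simp: X_def len)
    qed
    show "pbounded UNIV E (\<lambda>z. 1 + T0 z + (X z * I z + (1 + (L z + L z))))"
      unfolding I_def L_def by (intro pbounded_intros pbounded_poly X b c0)
  qed
  from ptime_on_right[OF ptime_on_right[OF this]] show ?thesis
    by (simp add: e_def enc_pair_def)
qed

lemmas ptime_vars = ptime_on_id ptime_fst ptime_snd

lemma tree_size_fold_le:
  assumes "\<And>x y. tree_size (e (h x y)) \<le> tree_size (e y) + c"
  shows "tree_size (e (fold h xs y)) \<le> tree_size (e y) + c * length xs"
proof (induction xs arbitrary: y)
  case (Cons x xs)
  show ?case using Cons[of "h x y"] assms[of x y] by simp
qed simp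

lemma length_le_tree_size_enc_list: "length xs \<le> tree_size (enc_list e xs)"
  by (induction xs) auto

text \<open>Polynomial-time steps alone do not make a polynomial-time loop, as iterated doubling
  shows; the accumulator has to stay small. Growth by a constant per step is a convenient sufficient
  condition.\<close>

lemma ptime_fold_additive:
  assumes xs: "ptime E (\<lambda>z. enc_list ex (xs z))"
    and a: "ptime E (\<lambda>z. ey (a z))"
    and h: "ptime (enc_pair E (enc_pair ex ey)) (\<lambda>p. ey (h (fst p) (fst (snd p)) (snd (snd p))))"
    and c: "\<And>z x y. tree_size (ey (h z x y)) \<le> tree_size (ey y) + c"
  shows "ptime E (\<lambda>z. ey (fold (h z) (xs z) (a z)))"
proof (rule ptime_fold[OF xs a h])
  show "pbounded UNIV E (\<lambda>z. tree_size (ey (a z)) + c * tree_size (enc_list ex (xs z)))"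
    by (intro pbounded_intros ptime_on_size[OF xs] ptime_on_size[OF a])
  fix z ys zs assume z: "xs z = ys @ zs"
  have "length ys \<le> tree_size (enc_list ex (xs z))"
    using length_le_tree_size_enc_list[of "xs z" ex] z by simp
  then have "c * length ys \<le> c * tree_size (enc_list ex (xs z))" by simp
  then show "tree_size (ey (fold (h z) ys (a z))) \<le> tree_size (ey (a z)) + c * tree_size (enc_list ex (xs z))"
    using tree_size_fold_le[of ey "h z" c ys "a z"] c by (meson add_le_mono le_trans order_refl)
qed


subsection \<open>Lists\<close>

lemma ptime_Nil: "ptime E (\<lambda>z. enc_list e [])"
  by (simp add: ptime_on_const)

lemma ptime_Cons:
  "ptime E (\<lambda>z. e (x z)) \<Longrightarrow> ptime E (\<lambda>z. enc_list e (xs z)) \<Longrightarrow>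
    ptime E (\<lambda>z. enc_list e (x z # xs z))"
  by (simp add: ptime_on_Node)

lemma right_enc_list: "right (enc_list e xs) = enc_list e (tl xs)"
  by (cases xs) auto

lemma ptime_tl: "ptime E (\<lambda>z. enc_list e (xs z)) \<Longrightarrow> ptime E (\<lambda>z. enc_list e (tl (xs z)))"
  using ptime_on_right[of UNIV E "\<lambda>z. enc_list e (xs z)"] by (simp add: right_enc_list)

lemma tree_size_enc_list: "tree_size (enc_list e xs) = 1 + (\<Sum>x\<leftarrow>xs. 1 + tree_size (e x))"
  by (induction xs) auto

lemma tree_size_enc_list_rev [simp]: "tree_size (enc_list e (rev xs)) = tree_size (enc_list e xs)"
  by (simp add: tree_size_enc_list rev_map[symmetric])

lemma tree_size_enc_list_prefix:
  "tree_size (enc_list e xs) \<le> tree_size (enc_list e (xs @ ys))"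
  by (simp add: tree_size_enc_list)

lemma tree_size_enc_list_elem: "x \<in> set xs \<Longrightarrow> tree_size (e x) \<le> tree_size (enc_list e xs)"
  by (induction xs) auto

lemma ptime_rev:
  assumes "ptime E (\<lambda>z. enc_list e (xs z))"
  shows "ptime E (\<lambda>z. enc_list e (rev (xs z)))"
proof -
  have "ptime E (\<lambda>z. enc_list e (fold Cons (xs z) []))"
  proof (rule ptime_fold[where h="\<lambda>_. Cons" and ey="enc_list e" and a="\<lambda>_. []", OF assms ptime_Nil _ ptime_on_size[OF assms]])
    show "ptime (enc_pair E (enc_pair e (enc_list e))) (\<lambda>p. enc_list e (fst (snd p) # snd (snd p)))"
      by (rule ptime_Cons ptime_vars)+
    fix z ys zs assume "xs z = ys @ zs"
    then show "tree_size (enc_list e (fold Cons ys [])) \<le> tree_size (enc_list e (xs z))"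
      using tree_size_enc_list_prefix[of e ys zs] by (simp flip: rev_conv_fold)
  qed
  then show ?thesis by (simp add: rev_conv_fold)
qed

lemma ptime_append:
  assumes xs: "ptime E (\<lambda>z. enc_list e (xs z))" and ys: "ptime E (\<lambda>z. enc_list e (ys z))"
  shows "ptime E (\<lambda>z. enc_list e (xs z @ ys z))"
proof -
  have "ptime E (\<lambda>z. enc_list e (fold Cons (rev (xs z)) (ys z)))"
  proof (rule ptime_fold[where h="\<lambda>_. Cons" and ey="enc_list e" and a=ys, OF ptime_rev[OF xs] ys _
        pbounded_add[OF ptime_on_size[OF xs] ptime_on_size[OF ys]]])
    show "ptime (enc_pair E (enc_pair e (enc_list e))) (\<lambda>p. enc_list e (fst (snd p) # snd (snd p)))"
      by (rule ptime_Cons ptime_vars)+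
    fix z us vs assume z: "rev (xs z) = us @ vs"
    have "fold Cons us (ys z) = rev us @ ys z"
      by (simp add: fold_Cons_rev)
    moreover have "tree_size (enc_list e (rev us)) \<le> tree_size (enc_list e (xs z))"
      using tree_size_enc_list_prefix[of e us vs] by (simp flip: z)
    ultimately show "tree_size (enc_list e (fold Cons us (ys z)))
        \<le> tree_size (enc_list e (xs z)) + tree_size (enc_list e (ys z))"
      using tree_size_enc_list_append[of e "rev us" "ys z"] by simp
  qed
  then show ?thesis by (simp add: fold_Cons_rev)
qed

text \<open>The accumulator is a reversed prefix of the result. One polynomial in the sizes of the
  environment and the whole list bounds each entry, hence length times that polynomial bounds the
  prefix.\<close>

lemma ptime_map:
  assumes xs: "ptime E (\<lambda>z. enc_list ex (xs z))"
    and g: "ptime (enc_pair E ex) (\<lambda>p. ey (g (fst p) (snd p)))"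
  shows "ptime E (\<lambda>z. enc_list ey (map (g z) (xs z)))"
proof -
  let ?X = "\<lambda>z. tree_size (enc_list ex (xs z))"
  obtain p where p: "\<And>z x. tree_size (ey (g z x)) \<le> poly p (1 + tree_size (E z) + tree_size (ex x))"
    using ptime_on_size[OF g] unfolding pbounded_def by (auto simp: enc_pair_def)
  let ?P = "\<lambda>z. poly p (1 + tree_size (E z) + ?X z)"
  have bound: "tree_size (enc_list ey (map (g z) ys)) \<le> 1 + ?X z * (1 + ?P z)"
    if "set ys \<subseteq> set (xs z)" "length ys \<le> length (xs z)" for z ys
  proof -
    have "tree_size (ey (g z x)) \<le> ?P z" if "x \<in> set ys" for x
      using p[of z x] poly_nat_mono[of "1 + tree_size (E z) + tree_size (ex x)" "1 + tree_size (E z) + ?X z" p]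
        tree_size_enc_list_elem[of x "xs z" ex] that \<open>set ys \<subseteq> set (xs z)\<close>
      by (meson add_left_mono le_trans subsetD)
    then have "(\<Sum>x\<leftarrow>ys. 1 + tree_size (ey (g z x))) \<le> (\<Sum>x\<leftarrow>ys. 1 + ?P z)"
      by (intro sum_list_mono) simp
    also have "\<dots> = length ys * (1 + ?P z)" by (simp add: sum_list_triv)
    also have "\<dots> \<le> ?X z * (1 + ?P z)"
      using length_le_tree_size_enc_list[of "xs z" ex] that by (intro mult_right_mono) auto
    finally show ?thesis by (simp add: tree_size_enc_list comp_def)
  qed
  have fold: "fold (\<lambda>x ys. g z x # ys) ys us = rev (map (g z) ys) @ us" for z ys us
    by (induction ys arbitrary: us) auto
  have "ptime E (\<lambda>z. enc_list ey (fold (\<lambda>x ys. g z x # ys) (xs z) []))"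
  proof (rule ptime_fold[where h="\<lambda>z x ys. g z x # ys" and ey="enc_list ey" and a="\<lambda>_. []", OF xs ptime_Nil])
    have "ptime (enc_pair E (enc_pair ex (enc_list ey)))
        (\<lambda>p. enc_pair E ex (fst p, fst (snd p)))"
      by (rule ptime_pair ptime_vars)+
    from ptime_comp[OF g this]
    show "ptime (enc_pair E (enc_pair ex (enc_list ey)))
        (\<lambda>p. enc_list ey (g (fst p) (fst (snd p)) # snd (snd p)))"
      by (intro ptime_Cons) (simp, (rule ptime_vars)+)
    show "pbounded UNIV E (\<lambda>z. 1 + ?X z * (1 + ?P z))"
      by (intro pbounded_intros pbounded_poly ptime_on_size[OF xs])
    fix z ys zs assume "xs z = ys @ zs"
    then show "tree_size (enc_list ey (fold (\<lambda>x ys. g z x # ys) ys [])) \<le> 1 + ?X z * (1 + ?P z)"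
      using bound[of ys z] by (simp add: fold)
  qed
  from ptime_rev[OF this] show ?thesis by (simp add: fold)
qed

lemma tree_size_enc_list_concat:
  "tree_size (enc_list e (concat xss)) \<le> tree_size (enc_list (enc_list e) xss)"
proof (induction xss)
  case (Cons xs xss)
  then show ?case using tree_size_enc_list_append[of e xs "concat xss"] by simp
qed simp

lemma ptime_concat:
  assumes "ptime E (\<lambda>z. enc_list (enc_list e) (xss z))"
  shows "ptime E (\<lambda>z. enc_list e (concat (xss z)))"
proof -
  have fold: "fold (\<lambda>xs ys. ys @ xs) xss us = us @ concat xss" for xss and us :: "'b list"
    by (induction xss arbitrary: us) auto
  have "ptime E (\<lambda>z. enc_list e (fold (\<lambda>xs ys. ys @ xs) (xss z) []))"
  proof (rule ptime_fold[where h="\<lambda>_ xs ys. ys @ xs" and ey="enc_list e" and a="\<lambda>_. []", OF assms ptime_Nil _ ptime_on_size[OF assms]])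
    show "ptime (enc_pair E (enc_pair (enc_list e) (enc_list e)))
        (\<lambda>p. enc_list e (snd (snd p) @ fst (snd p)))"
      by (rule ptime_append ptime_vars)+
    fix z ys zs assume "xss z = ys @ zs"
    then show "tree_size (enc_list e (fold (\<lambda>xs ys. ys @ xs) ys [])) \<le> tree_size (enc_list (enc_list e) (xss z))"
      using tree_size_enc_list_prefix[of "enc_list e" ys zs] tree_size_enc_list_concat[of e ys]
      by (simp add: fold)
  qed
  then show ?thesis by (simp add: fold)
qed


text \<open>The side condition excludes \<open>hd []\<close>, an unspecified value; the program
  would return \<open>Leaf\<close> there.\<close>

lemma ptime_hd:
  assumes "ptime E (\<lambda>z. enc_list e (xs z))" "\<And>z. xs z \<noteq> []"
  shows "ptime E (\<lambda>z. e (hd (xs z)))"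
proof (rule ptime_on_cong[OF ptime_on_left[OF assms(1)]])
  fix z show "left (enc_list e (xs z)) = e (hd (xs z))" using assms(2)[of z] by (cases "xs z") auto
qed


subsection \<open>Truth values\<close>

definition enc_bool :: "bool \<Rightarrow> tree" where
  "enc_bool b = (if b then Node Leaf Leaf else Leaf)"

lemma ptime_if:
  assumes "ptime E (\<lambda>z. enc_bool (P z))" "ptime E (\<lambda>z. e (f z))" "ptime E (\<lambda>z. e (g z))"
  shows "ptime E (\<lambda>z. e (if P z then f z else g z))"
  by (rule ptime_on_cong[OF ptime_on_if[OF assms]]) (simp add: enc_bool_def)

lemma ptime_True: "ptime E (\<lambda>z. enc_bool True)"
  and ptime_False: "ptime E (\<lambda>z. enc_bool False)"
  by (rule ptime_on_const)+

lemma ptime_not: "ptime E (\<lambda>z. enc_bool (P z)) \<Longrightarrow> ptime E (\<lambda>z. enc_bool (\<not> P z))"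
  by (rule ptime_on_cong[OF ptime_if[where e=enc_bool, OF _ ptime_False ptime_True, of E P]]) auto

lemma ptime_conj:
  "ptime E (\<lambda>z. enc_bool (P z)) \<Longrightarrow> ptime E (\<lambda>z. enc_bool (Q z)) \<Longrightarrow> ptime E (\<lambda>z. enc_bool (P z \<and> Q z))"
  by (rule ptime_on_cong[OF ptime_if[where e=enc_bool, OF _ _ ptime_False, of E P Q]]) auto

lemma ptime_disj:
  "ptime E (\<lambda>z. enc_bool (P z)) \<Longrightarrow> ptime E (\<lambda>z. enc_bool (Q z)) \<Longrightarrow> ptime E (\<lambda>z. enc_bool (P z \<or> Q z))"
  by (rule ptime_on_cong[OF ptime_if[where e=enc_bool, OF _ ptime_True, of E P Q]]) auto

lemma ptime_eq:
  assumes "inj e" "ptime E (\<lambda>z. e (f z))" "ptime E (\<lambda>z. e (g z))"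
  shows "ptime E (\<lambda>z. enc_bool (f z = g z))"
  by (rule ptime_on_cong[OF ptime_on_eq[OF assms(2,3)]]) (simp add: enc_bool_def inj_eq[OF assms(1)])

lemma inj_enc_bool: "inj enc_bool"
  by (auto simp: inj_on_def enc_bool_def)

lemma inj_enc_list: "inj e \<Longrightarrow> inj (enc_list e)"
proof (rule injI)
  fix xs ys assume "inj e" "enc_list e xs = enc_list e ys"
  then show "xs = ys"
  proof (induction xs arbitrary: ys)
    case Nil
    then show ?case by (cases ys) auto
  next
    case (Cons x xs)
    then show ?case by (cases ys) (auto dest: injD)
  qed
qed

lemma ptime_null: "ptime E (\<lambda>z. enc_list e (xs z)) \<Longrightarrow> ptime E (\<lambda>z. enc_bool (xs z = []))"
  by (rule ptime_on_cong[OF ptime_on_eq[OF _ ptime_on_Leaf, of UNIV E "\<lambda>z. enc_list e (xs z)"]])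
     (auto simp: enc_bool_def neq_Nil_conv)

lemma ptime_filter:
  assumes xs: "ptime E (\<lambda>z. enc_list e (xs z))"
    and P: "ptime (enc_pair E e) (\<lambda>p. enc_bool (P (fst p) (snd p)))"
  shows "ptime E (\<lambda>z. enc_list e (filter (P z) (xs z)))"
proof -
  have "ptime E (\<lambda>z. enc_list e (concat (map (\<lambda>x. if P z x then [x] else []) (xs z))))"
    by (rule ptime_concat ptime_map[OF xs] ptime_if[where e="enc_list e"] P ptime_Nil ptime_Cons ptime_vars)+
  moreover have "concat (map (\<lambda>x. if P z x then [x] else []) ys) = filter (P z) ys" for z ys
    by (induction ys) auto
  ultimately show ?thesis by simp
qed

lemma ptime_all:
  assumes xs: "ptime E (\<lambda>z. enc_list e (xs z))"
    and P: "ptime (enc_pair E e) (\<lambda>p. enc_bool (P (fst p) (snd p)))"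
  shows "ptime E (\<lambda>z. enc_bool (\<forall>x \<in> set (xs z). P z x))"
  by (rule ptime_on_cong[OF ptime_null[OF ptime_filter[OF xs ptime_not[OF P]]]])
     (simp add: filter_empty_conv)

lemma ptime_member:
  assumes "inj e" and xs: "ptime E (\<lambda>z. enc_list e (xs z))" and x: "ptime E (\<lambda>z. e (x z))"
  shows "ptime E (\<lambda>z. enc_bool (x z \<in> set (xs z)))"
proof -
  have "ptime (enc_pair E e) (\<lambda>p. e (x (fst p)))"
    by (rule ptime_comp[OF x]) (rule ptime_vars)+
  then have "ptime (enc_pair E e) (\<lambda>p. enc_bool (x (fst p) \<noteq> snd p))"
    by (intro ptime_not ptime_eq[OF assms(1)]) (assumption, (rule ptime_vars)+)
  from ptime_not[OF ptime_all[OF xs this]] show ?thesis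
    by (rule ptime_on_cong) auto
qed

subsection \<open>Unary numbers\<close>

text \<open>A unary number is a list of units. Addition becomes concatenation, and an
  \<open>n\<close>-fold iteration becomes a fold over \<open>replicate n ()\<close>.\<close>

lemma enc_unary_replicate: "enc_unary n = enc_list (\<lambda>_. Leaf) (replicate n ())"
  by (induction n) auto

lemma tree_size_enc_unary [simp]: "tree_size (enc_unary n) = 2 * n + 1"
  by (induction n) auto

lemma inj_enc_unary: "inj enc_unary"
  by (rule injI) (metis tree_size_enc_unary add_right_cancel mult_cancel1 zero_neq_numeral)

lemma ptime_unary_const: "ptime E (\<lambda>z. enc_unary n)"
  by (rule ptime_on_const)

lemma ptime_unary_Suc: "ptime E (\<lambda>z. enc_unary (f z)) \<Longrightarrow> ptime E (\<lambda>z. enc_unary (Suc (f z)))"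
  by (simp add: ptime_on_Node ptime_on_Leaf)

lemma ptime_unary_add:
  "ptime E (\<lambda>z. enc_unary (f z)) \<Longrightarrow> ptime E (\<lambda>z. enc_unary (g z)) \<Longrightarrow>
    ptime E (\<lambda>z. enc_unary (f z + g z))"
  unfolding enc_unary_replicate replicate_add by (rule ptime_append)

lemma ptime_length:
  assumes "ptime E (\<lambda>z. enc_list e (xs z))"
  shows "ptime E (\<lambda>z. enc_unary (length (xs z)))"
proof -
  have "ptime E (\<lambda>z. enc_list (\<lambda>_. Leaf) (map (\<lambda>_. ()) (xs z)))"
    by (rule ptime_map[OF assms]) (rule ptime_on_Leaf)
  then show ?thesis unfolding enc_unary_replicate by (simp add: map_replicate_const)
qed

lemma ptime_sum_list:
  assumes xs: "ptime E (\<lambda>z. enc_list e (xs z))"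
    and g: "ptime (enc_pair E e) (\<lambda>p. enc_unary (g (fst p) (snd p)))"
  shows "ptime E (\<lambda>z. enc_unary (\<Sum>x\<leftarrow>xs z. g z x))"
proof -
  have "ptime E (\<lambda>z. enc_list (\<lambda>_. Leaf) (concat (map (\<lambda>x. replicate (g z x) ()) (xs z))))"
    by (rule ptime_concat, rule ptime_map[OF xs], fold enc_unary_replicate, rule g)
  moreover have "concat (map (\<lambda>x. replicate (g z x) ()) ys) = replicate (\<Sum>x\<leftarrow>ys. g z x) ()" for z ys
    by (induction ys) (auto simp: replicate_add)
  ultimately show ?thesis unfolding enc_unary_replicate by simp
qed

lemma ptime_unary_mult:
  assumes f: "ptime E (\<lambda>z. enc_unary (f z))" and g: "ptime E (\<lambda>z. enc_unary (g z))"
  shows "ptime E (\<lambda>z. enc_unary (f z * g z))"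
proof -
  have "ptime E (\<lambda>z. enc_unary (\<Sum>x\<leftarrow>replicate (f z) (). g z))"
  proof (rule ptime_sum_list)
    show "ptime E (\<lambda>z. enc_list (\<lambda>_. Leaf) (replicate (f z) ()))"
      using f by (simp add: enc_unary_replicate)
    show "ptime (enc_pair E (\<lambda>_. Leaf)) (\<lambda>p. enc_unary (g (fst p)))"
      by (rule ptime_comp[OF g]) (rule ptime_vars)+
  qed
  then show ?thesis by (simp add: sum_list_replicate)
qed

lemma ptime_unary_pred: "ptime E (\<lambda>z. enc_unary (f z)) \<Longrightarrow> ptime E (\<lambda>z. enc_unary (f z - 1))"
proof -
  have "right (enc_unary n) = enc_unary (n - 1)" for n by (cases n) auto
  then show "ptime E (\<lambda>z. enc_unary (f z)) \<Longrightarrow> ptime E (\<lambda>z. enc_unary (f z - 1))"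
    using ptime_on_right[of UNIV E "\<lambda>z. enc_unary (f z)"] by simp
qed

lemma ptime_unary_diff:
  assumes f: "ptime E (\<lambda>z. enc_unary (f z))" and g: "ptime E (\<lambda>z. enc_unary (g z))"
  shows "ptime E (\<lambda>z. enc_unary (f z - g z))"
proof -
  have fold: "fold (\<lambda>_ n. n - 1) (replicate m ()) n = n - m" for m n :: nat
    by (induction m arbitrary: n) auto
  have "ptime E (\<lambda>z. enc_unary (fold (\<lambda>_ n. n - 1) (replicate (g z) ()) (f z)))"
  proof (rule ptime_fold_additive[where h="\<lambda>_ _ n. n - 1" and ey=enc_unary and a=f])
    show "ptime E (\<lambda>z. enc_list (\<lambda>_. Leaf) (replicate (g z) ()))"
      using g by (simp add: enc_unary_replicate)
    show "ptime (enc_pair E (enc_pair (\<lambda>_. Leaf) enc_unary)) (\<lambda>p. enc_unary (snd (snd p) - 1))"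
      by (rule ptime_unary_pred ptime_vars)+
    show "tree_size (enc_unary (n - 1)) \<le> tree_size (enc_unary n) + 0" for n by simp
  qed (rule f)
  then show ?thesis by (simp only: fold)
qed

lemma ptime_unary_zero: "ptime E (\<lambda>z. enc_unary (f z)) \<Longrightarrow> ptime E (\<lambda>z. enc_bool (f z = 0))"
  by (rule ptime_eq[OF inj_enc_unary _ ptime_unary_const])

lemma ptime_unary_le:
  "ptime E (\<lambda>z. enc_unary (f z)) \<Longrightarrow> ptime E (\<lambda>z. enc_unary (g z)) \<Longrightarrow>
    ptime E (\<lambda>z. enc_bool (f z \<le> g z))"
  by (rule ptime_on_cong[OF ptime_unary_zero[OF ptime_unary_diff[of E f g]]]) auto

text \<open>A counter that is reset on reaching \<open>g z\<close> advances \<open>f z\<close>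
  times. For modulus 0 it is never reset, in agreement with \<open>t mod 0 = t\<close>.\<close>

lemma ptime_unary_mod:
  assumes f: "ptime E (\<lambda>z. enc_unary (f z))" and g: "ptime E (\<lambda>z. enc_unary (g z))"
  shows "ptime E (\<lambda>z. enc_unary (f z mod g z))"
proof -
  define h where "h d c = (if Suc c = d then 0 else Suc c)" for d c :: nat
  have fold: "fold (\<lambda>_. h d) (replicate t ()) 0 = t mod d" for t d
  proof (induction t)
    case (Suc t)
    have "fold (\<lambda>_. h d) (replicate (Suc t) ()) 0 = h d (fold (\<lambda>_. h d) (replicate t ()) 0)"
      unfolding replicate_append_same[symmetric] replicate_Suc by simp
    also have "\<dots> = Suc t mod d" unfolding Suc by (simp add: h_def mod_Suc)
    finally show ?case .
  qed simp
  have "ptime E (\<lambda>z. enc_unary (fold (\<lambda>_. h (g z)) (replicate (f z) ()) 0))"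
  proof (rule ptime_fold_additive[where h="\<lambda>z _. h (g z)" and ey=enc_unary and a="\<lambda>_. 0"])
    show "ptime E (\<lambda>z. enc_list (\<lambda>_. Leaf) (replicate (f z) ()))"
      using f by (simp add: enc_unary_replicate)
    have "ptime (enc_pair E (enc_pair (\<lambda>_::unit. Leaf) enc_unary)) (\<lambda>p. enc_unary (g (fst p)))"
      by (rule ptime_comp[OF g]) (rule ptime_vars)+
    then show "ptime (enc_pair E (enc_pair (\<lambda>_::unit. Leaf) enc_unary))
        (\<lambda>p. enc_unary (h (g (fst p)) (snd (snd p))))"
      unfolding h_def
      by (intro ptime_if[where e=enc_unary] ptime_eq[OF inj_enc_unary] ptime_unary_const ptime_unary_Suc)
         (assumption | rule ptime_vars)+
    show "tree_size (enc_unary (h (g z) n)) \<le> tree_size (enc_unary n) + 2" for z n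
      by (simp add: h_def)
  qed (rule ptime_unary_const)
  then show ?thesis by (simp only: fold)
qed

text \<open>The length of the accumulator is the next number, so the loop carries no separate
  counter.\<close>

lemma ptime_upt:
  assumes f: "ptime E (\<lambda>z. enc_unary (f z))"
  shows "ptime E (\<lambda>z. enc_list enc_unary [0..<f z])"
proof -
  have fold: "fold (\<lambda>_ ys. length ys # ys) us [] = rev [0..<length us]" for us :: "unit list"
    by (induction us rule: rev_induct) auto
  let ?X = "\<lambda>z. tree_size (enc_unary (f z))"
  have "ptime E (\<lambda>z. enc_list enc_unary (fold (\<lambda>_ ys. length ys # ys) (replicate (f z) ()) []))"
  proof (rule ptime_fold[where h="\<lambda>_ _ ys. length ys # ys" and ey="enc_list enc_unary" and a="\<lambda>_. []"])
    show "ptime E (\<lambda>z. enc_list (\<lambda>_. Leaf) (replicate (f z) ()))"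
      using f by (simp add: enc_unary_replicate)
    show "ptime (enc_pair E (enc_pair (\<lambda>_::unit. Leaf) (enc_list enc_unary)))
        (\<lambda>p. enc_list enc_unary (length (snd (snd p)) # snd (snd p)))"
      by (rule ptime_Cons ptime_length ptime_vars)+
    show "pbounded UNIV E (\<lambda>z. 1 + ?X z * (1 + ?X z))"
      by (intro pbounded_intros ptime_on_size[OF f])
    fix z ys zs assume "replicate (f z) () = ys @ zs"
    then have len: "length ys \<le> f z" by (metis length_append length_replicate le_add1)
    have "(\<Sum>x\<leftarrow>[0..<length ys]. 1 + tree_size (enc_unary x)) \<le> (\<Sum>x\<leftarrow>[0..<length ys]. 1 + ?X z)"
      using len by (intro sum_list_mono) auto
    also have "\<dots> = length ys * (1 + ?X z)" by (simp add: sum_list_triv)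
    also have "\<dots> \<le> ?X z * (1 + ?X z)" using len by (intro mult_right_mono) auto
    finally show "tree_size (enc_list enc_unary (fold (\<lambda>_ ys. length ys # ys) ys [])) \<le> 1 + ?X z * (1 + ?X z)"
      unfolding fold tree_size_enc_list_rev unfolding tree_size_enc_list by linarith
  qed (rule ptime_Nil)
  from ptime_rev[OF this] show ?thesis by (simp only: fold length_replicate rev_rev_ident)
qed

text \<open>The default 0 is what a program reads beyond the end, since \<open>left Leaf\<close> is
  \<open>Leaf\<close>, the encoding of 0. It is also a legal value whenever
  \<open>0 < q\<close>.\<close>

definition nth0 :: "nat list \<Rightarrow> nat \<Rightarrow> nat" where
  "nth0 xs i = (if i < length xs then xs ! i else 0)"

lemma ptime_nth0:
  assumes xs: "ptime E (\<lambda>z. enc_list enc_unary (xs z))" and f: "ptime E (\<lambda>z. enc_unary (f z))"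
  shows "ptime E (\<lambda>z. enc_unary (nth0 (xs z) (f z)))"
proof -
  have fold: "fold (\<lambda>_. tl) (replicate m ()) ys = drop m ys" for m and ys :: "nat list"
    by (induction m arbitrary: ys) (auto simp: drop_Suc)
  have left: "left (enc_list enc_unary (drop m ys)) = enc_unary (nth0 ys m)" for m ys
    by (cases "m < length ys") (auto simp: nth0_def Cons_nth_drop_Suc[symmetric])
  have "ptime E (\<lambda>z. enc_list enc_unary (fold (\<lambda>_. tl) (replicate (f z) ()) (xs z)))"
  proof (rule ptime_fold_additive[where h="\<lambda>_ _. tl" and ey="enc_list enc_unary" and a=xs])
    show "ptime E (\<lambda>z. enc_list (\<lambda>_. Leaf) (replicate (f z) ()))"
      using f by (simp add: enc_unary_replicate)
    show "ptime (enc_pair E (enc_pair (\<lambda>_::unit. Leaf) (enc_list enc_unary)))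
        (\<lambda>p. enc_list enc_unary (tl (snd (snd p))))"
      by (rule ptime_tl ptime_vars)+
    show "tree_size (enc_list enc_unary (tl ys)) \<le> tree_size (enc_list enc_unary ys) + 0" for ys
      by (cases ys) auto
  qed (rule xs)
  from ptime_on_left[OF this] show ?thesis by (simp only: fold left)
qed


subsection \<open>Binary numbers\<close>

fun bits :: "nat \<Rightarrow> bool list" where
  "bits n = (if n = 0 then [] else odd n # bits (n div 2))"

declare bits.simps [simp del]

lemma enc_binary_bits: "enc_binary n = enc_list enc_bool (bits n)"
proof (induction n rule: bits.induct)
  case (1 n)
  then show ?case by (cases "n = 0") (auto simp: bits.simps[of n] enc_binary.simps[of n] bits.simps[of 0] enc_binary.simps[of 0] enc_bool_def)
qed

lemma inj_enc_binary: "inj enc_binary"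
proof (rule injI)
  fix m n assume "enc_binary m = enc_binary n"
  then show "m = n"
  proof (induction m arbitrary: n rule: bits.induct)
    case (1 m)
    show ?case
    proof (cases "m = 0 \<or> n = 0")
      case True
      then show ?thesis using 1(2) by (auto simp: enc_binary.simps[of m] enc_binary.simps[of n] split: if_splits)
    next
      case False
      then have "odd m = odd n" "m div 2 = n div 2"
        using 1 by (auto simp: enc_binary.simps[of m] enc_binary.simps[of n] split: if_splits)
      then show ?thesis by (metis div_mult_mod_eq odd_iff_mod_2_eq_one even_iff_mod_2_eq_zero)
    qed
  qed
qed

lemma less_two_power_length_bits: "n < 2 ^ length (bits n)"
proof (induction n rule: bits.induct)
  case (1 n)
  then show ?case by (cases "n = 0") (auto simp: bits.simps[of n])
qed

lemma length_bits_le: "n < 2 ^ k \<Longrightarrow> length (bits n) \<le> k"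
proof (induction n arbitrary: k rule: bits.induct)
  case (1 n)
  show ?case
  proof (cases "n = 0")
    case False
    then obtain j where k: "k = Suc j" using 1(2) by (cases k) auto
    then have "n div 2 < 2 ^ j" using 1(2) by auto
    then show ?thesis using 1(1)[OF False, of j] False k by (simp add: bits.simps[of n])
  qed (simp add: bits.simps)
qed

lemma tree_size_enc_binary_le: "n < 2 ^ k \<Longrightarrow> tree_size (enc_binary n) \<le> 1 + 4 * k"
proof -
  have "tree_size (enc_list enc_bool bs) \<le> 1 + 4 * length bs" for bs
    by (induction bs) (auto simp: enc_bool_def)
  then show "n < 2 ^ k \<Longrightarrow> tree_size (enc_binary n) \<le> 1 + 4 * k"
    using length_bits_le[of n k] unfolding enc_binary_bits
    by (metis add_left_mono le_trans mult_le_mono2)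
qed

lemma tree_size_enc_binary_half: "tree_size (enc_binary (n div 2)) \<le> tree_size (enc_binary n)"
  by (cases "n = 0") (simp_all add: enc_binary.simps[of n])

lemma ptime_binary_const: "ptime E (\<lambda>z. enc_binary n)"
  by (rule ptime_on_const)

lemma ptime_binary_zero: "ptime E (\<lambda>z. enc_binary (f z)) \<Longrightarrow> ptime E (\<lambda>z. enc_bool (f z = 0))"
  by (rule ptime_eq[OF inj_enc_binary _ ptime_binary_const])

lemma ptime_binary_half: "ptime E (\<lambda>z. enc_binary (f z)) \<Longrightarrow> ptime E (\<lambda>z. enc_binary (f z div 2))"
proof -
  have "right (enc_binary n) = enc_binary (n div 2)" for n
    by (cases "n = 0") (simp_all add: enc_binary.simps[of n] enc_binary.simps[of 0])
  then show "ptime E (\<lambda>z. enc_binary (f z)) \<Longrightarrow> ptime E (\<lambda>z. enc_binary (f z div 2))"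
    using ptime_on_right[of UNIV E "\<lambda>z. enc_binary (f z)"] by simp
qed

lemma ptime_binary_odd: "ptime E (\<lambda>z. enc_binary (f z)) \<Longrightarrow> ptime E (\<lambda>z. enc_bool (odd (f z)))"
proof -
  have "left (enc_binary n) = enc_bool (odd n)" for n
    by (cases "n = 0") (auto simp: enc_binary.simps[of n] enc_binary.simps[of 0] enc_bool_def)
  then show "ptime E (\<lambda>z. enc_binary (f z)) \<Longrightarrow> ptime E (\<lambda>z. enc_bool (odd (f z)))"
    using ptime_on_left[of UNIV E "\<lambda>z. enc_binary (f z)"] by simp
qed

lemma ptime_binary_double:
  assumes n: "ptime E (\<lambda>z. enc_binary (f z))" and b: "ptime E (\<lambda>z. enc_bool (b z))"
  shows "ptime E (\<lambda>z. enc_binary (2 * f z + of_bool (b z)))"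
proof -
  have "ptime E (\<lambda>z. enc_list enc_bool (if f z = 0 \<and> \<not> b z then [] else b z # bits (f z)))"
    by (intro ptime_if[where e="enc_list enc_bool"] ptime_conj ptime_not ptime_binary_zero n b
        ptime_Nil ptime_Cons) (use n in \<open>simp add: enc_binary_bits\<close>)
  moreover have "enc_binary (2 * m + of_bool c) = enc_list enc_bool (if m = 0 \<and> \<not> c then [] else c # bits m)"
    for m c unfolding enc_binary_bits by (subst bits.simps) auto
  ultimately show ?thesis by simp
qed

text \<open>Most significant digit first, the opposite of \<open>bits\<close>. This is the order in
  which digits produced from the low end pile up on a list.\<close>

definition horner :: "bool list \<Rightarrow> nat" where
  "horner bs = fold (\<lambda>b n. 2 * n + of_bool b) bs 0"

lemma fold_horner: "fold (\<lambda>b n. 2 * n + of_bool b) bs m = m * 2 ^ length bs + horner bs"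
proof (induction bs arbitrary: m)
  case (Cons b bs)
  have "horner (b # bs) = of_bool b * 2 ^ length bs + horner bs"
    unfolding horner_def using Cons[of "of_bool b"] by (simp add: horner_def)
  then show ?case using Cons[of "2 * m + of_bool b"] by (simp add: algebra_simps)
qed (simp add: horner_def)

lemma horner_Cons: "horner (b # bs) = of_bool b * 2 ^ length bs + horner bs"
  using fold_horner[of bs "of_bool b"] by (simp add: horner_def)

lemma horner_less: "horner bs < 2 ^ length bs"
proof (induction bs)
  case (Cons b bs)
  then show ?case by (cases b) (simp_all add: horner_Cons)
qed (simp add: horner_def)

lemma horner_rev_bits: "horner (rev (bits n)) = n"
proof (induction n rule: bits.induct)
  case (1 n)
  show ?case
  proof (cases "n = 0")
    case False
    then have "horner (rev (bits n)) = 2 * horner (rev (bits (n div 2))) + of_bool (odd n)"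
      by (simp add: bits.simps[of n] horner_def)
    then show ?thesis using 1[OF False] by (metis mult_div_mod_eq of_bool_odd_eq_mod_2)
  qed (simp add: horner_def bits.simps)
qed

lemma ptime_horner:
  assumes bs: "ptime E (\<lambda>z. enc_list enc_bool (bs z))"
  shows "ptime E (\<lambda>z. enc_binary (horner (bs z)))"
  unfolding horner_def
proof (rule ptime_fold[where h="\<lambda>_ b n. 2 * n + of_bool b" and ey=enc_binary and a="\<lambda>_. 0"])
  show "ptime (enc_pair E (enc_pair enc_bool enc_binary))
      (\<lambda>p. enc_binary (2 * snd (snd p) + of_bool (fst (snd p))))"
    by (rule ptime_binary_double ptime_vars)+
  show "pbounded UNIV E (\<lambda>z. 1 + 4 * tree_size (enc_list enc_bool (bs z)))"
    by (intro pbounded_intros ptime_on_size[OF bs])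
  fix z us vs assume "bs z = us @ vs"
  then have "length us \<le> tree_size (enc_list enc_bool (bs z))"
    using length_le_tree_size_enc_list[of "bs z" enc_bool] by simp
  then show "tree_size (enc_binary (fold (\<lambda>b n. 2 * n + of_bool b) us 0))
      \<le> 1 + 4 * tree_size (enc_list enc_bool (bs z))"
    using tree_size_enc_binary_le[OF horner_less[of us]] unfolding horner_def by linarith
qed (rule bs ptime_binary_const)+

text \<open>The state of the addition: the two remaining numbers, the carry, and the digits produced so
  far, most significant first.\<close>

definition add_step :: "(nat \<times> nat) \<times> bool \<times> bool list \<Rightarrow> (nat \<times> nat) \<times> bool \<times> bool list" where
  "add_step s = ((fst (fst s) div 2, snd (fst s) div 2),
    (odd (fst (fst s)) \<and> odd (snd (fst s)) \<or> fst (snd s) \<and> (odd (fst (fst s)) \<or> odd (snd (fst s))),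
     (odd (fst (fst s)) \<noteq> (odd (snd (fst s)) \<noteq> fst (snd s))) # snd (snd s)))"

text \<open>The loop invariant: the digits already produced, plus the remaining operands and the
  carry at their current place value.\<close>

definition add_value :: "(nat \<times> nat) \<times> bool \<times> bool list \<Rightarrow> nat" where
  "add_value s = horner (snd (snd s)) +
    2 ^ length (snd (snd s)) * (fst (fst s) + snd (fst s) + of_bool (fst (snd s)))"

lemma add_value_step: "add_value (add_step s) = add_value s"
proof -
  obtain a b c out where s: "s = ((a, b), c, out)" by (metis surj_pair)
  have "a + b + of_bool c = of_bool (odd a \<noteq> (odd b \<noteq> c)) +
      2 * (a div 2 + b div 2 + of_bool (odd a \<and> odd b \<or> c \<and> (odd a \<or> odd b)))"
    by (cases c; cases "odd a"; cases "odd b") (auto elim!: oddE evenE)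
  then have "2 ^ length out * (a + b + of_bool c) = 2 ^ length out * (of_bool (odd a \<noteq> (odd b \<noteq> c)) +
      2 * (a div 2 + b div 2 + of_bool (odd a \<and> odd b \<or> c \<and> (odd a \<or> odd b))))" by simp
  then show ?thesis
    by (simp add: s add_value_def add_step_def horner_Cons algebra_simps)
qed

lemma fold_add_step:
  "add_value (fold (\<lambda>_. add_step) us s) = add_value s"
  "length (snd (snd (fold (\<lambda>_. add_step) us s))) = length us + length (snd (snd s))"
  by (induction us arbitrary: s) (auto simp: add_value_step, auto simp: add_step_def)

text \<open>The two digit lists serve as a clock, and \<open>[True]\<close> adds the one tick that
  makes \<open>a + b < 2 ^ Suc ?k\<close> evident. After that many steps, any remainder or carry
  would contribute at least \<open>2 ^ Suc ?k\<close> to the invariant, so the digits produced are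
  the whole sum.\<close>

lemma horner_add:
  "horner (snd (snd (fold (\<lambda>_. add_step) (bits a @ bits b @ [True]) ((a, b), False, [])))) = a + b"
proof -
  define r where "r = fold (\<lambda>_. add_step) (bits a @ bits b @ [True]) ((a, b), False, [])"
  let ?k = "length (bits a) + length (bits b)"
  have v: "add_value r = a + b"
    unfolding r_def fold_add_step by (simp add: add_value_def horner_def)
  have l: "length (snd (snd r)) = Suc ?k"
    unfolding r_def fold_add_step by simp
  have "a < 2 ^ ?k" "b < 2 ^ ?k"
    by (rule less_le_trans[OF less_two_power_length_bits power_increasing]; simp)+
  then have "add_value r < 2 ^ Suc ?k" using v by simp
  then have "2 ^ Suc ?k * (fst (fst r) + snd (fst r) + of_bool (fst (snd r))) < 2 ^ Suc ?k * (1::nat)"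
    unfolding add_value_def l by linarith
  then have "fst (fst r) + snd (fst r) + of_bool (fst (snd r)) = (0::nat)"
    unfolding mult_less_cancel1 by simp
  then show ?thesis using v unfolding add_value_def r_def by simp
qed

lemma ptime_binary_add:
  assumes f: "ptime E (\<lambda>z. enc_binary (f z))" and g: "ptime E (\<lambda>z. enc_binary (g z))"
  shows "ptime E (\<lambda>z. enc_binary (f z + g z))"
proof -
  let ?e = "enc_pair (enc_pair enc_binary enc_binary) (enc_pair enc_bool (enc_list enc_bool))"
  have "ptime E (\<lambda>z. ?e (fold (\<lambda>_. add_step) (bits (f z) @ bits (g z) @ [True]) ((f z, g z), False, [])))"
  proof (rule ptime_fold_additive[where h="\<lambda>_ _. add_step" and ey="?e" and a="\<lambda>z. ((f z, g z), False, [])"])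
    show "ptime E (\<lambda>z. enc_list enc_bool (bits (f z) @ bits (g z) @ [True]))"
      using f g by (intro ptime_append ptime_Cons ptime_Nil ptime_True) (simp_all add: enc_binary_bits)
    show "ptime E (\<lambda>z. ?e ((f z, g z), False, []))"
      by (intro ptime_pair f g ptime_False ptime_Nil)
    show "ptime (enc_pair E (enc_pair enc_bool ?e)) (\<lambda>p. ?e (add_step (snd (snd p))))"
      unfolding add_step_def
      by (rule ptime_pair ptime_Cons ptime_disj ptime_conj ptime_not ptime_eq[OF inj_enc_bool]
          ptime_binary_odd ptime_binary_half ptime_vars)+
    show "tree_size (?e (add_step s)) \<le> tree_size (?e s) + 6" for s
      using tree_size_enc_binary_half[of "fst (fst s)"] tree_size_enc_binary_half[of "snd (fst s)"]
      by (auto simp: add_step_def enc_pair_def enc_bool_def)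
  qed
  from ptime_horner[OF ptime_snd[OF ptime_snd[OF this]]] show ?thesis by (simp only: horner_add)
qed

text \<open>Double and add, from the top digit of \<open>g z\<close> downwards. After the digits
  \<open>us\<close> the accumulator is \<open>f z * horner us\<close>, which has no more digits than
  both factors together.\<close>

lemma ptime_binary_mult:
  assumes f: "ptime E (\<lambda>z. enc_binary (f z))" and g: "ptime E (\<lambda>z. enc_binary (g z))"
  shows "ptime E (\<lambda>z. enc_binary (f z * g z))"
proof -
  have fold: "fold (\<lambda>b n. 2 * n + (if b then a else 0)) bs (a * m) = a * fold (\<lambda>b n. 2 * n + of_bool b) bs m"
    for a m :: nat and bs
  proof (induction bs arbitrary: m)
    case (Cons b bs)
    show ?case using Cons[of "2 * m + of_bool b"] by (cases b) (simp_all add: algebra_simps)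
  qed simp
  have fold0: "fold (\<lambda>b n. 2 * n + (if b then a else 0)) bs 0 = a * horner bs" for a bs
    using fold[of a bs 0] by (simp add: horner_def)
  let ?F = "\<lambda>z. tree_size (enc_binary (f z))" and ?G = "\<lambda>z. tree_size (enc_binary (g z))"
  have "ptime E (\<lambda>z. enc_binary (fold (\<lambda>b n. 2 * n + (if b then f z else 0)) (rev (bits (g z))) 0))"
  proof (rule ptime_fold[where h="\<lambda>z b n. 2 * n + (if b then f z else 0)" and ey=enc_binary and a="\<lambda>_. 0"])
    show "ptime E (\<lambda>z. enc_list enc_bool (rev (bits (g z))))"
      using g by (intro ptime_rev) (simp add: enc_binary_bits)
    let ?E = "enc_pair E (enc_pair enc_bool enc_binary)"
    have 1: "ptime ?E (\<lambda>p. enc_binary (2 * snd (snd p) + of_bool False))"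
      by (rule ptime_binary_double ptime_False ptime_vars)+
    have 2: "ptime ?E (\<lambda>p. enc_binary (f (fst p)))"
      by (rule ptime_comp[OF f]) (rule ptime_vars)+
    have 3: "ptime ?E (\<lambda>p. enc_bool (fst (snd p)))"
      by (rule ptime_vars)+
    show "ptime ?E (\<lambda>p. enc_binary (2 * snd (snd p) + (if fst (snd p) then f (fst p) else 0)))"
      using ptime_binary_add[OF 1 ptime_if[where e=enc_binary, OF 3 2 ptime_binary_const]] by simp
    show "pbounded UNIV E (\<lambda>z. 1 + 4 * (?F z + ?G z))"
      by (intro pbounded_intros ptime_on_size[OF f] ptime_on_size[OF g])
    fix z us vs assume z: "rev (bits (g z)) = us @ vs"
    have "length us \<le> length (bits (g z))" using arg_cong[OF z, of length] by simp
    then have len: "length us \<le> ?G z"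
      using length_le_tree_size_enc_list[of "bits (g z)" enc_bool] by (simp add: enc_binary_bits)
    have len': "length (bits (f z)) \<le> ?F z"
      using length_le_tree_size_enc_list[of "bits (f z)" enc_bool] by (simp add: enc_binary_bits)
    have "f z * horner us < 2 ^ length (bits (f z)) * 2 ^ length us"
      by (rule mult_strict_mono[OF less_two_power_length_bits horner_less]) auto
    also have "\<dots> \<le> 2 ^ (?F z + ?G z)"
      unfolding power_add[symmetric] using len len' by (intro power_increasing) auto
    finally show "tree_size (enc_binary (fold (\<lambda>b n. 2 * n + (if b then f z else 0)) us 0)) \<le> 1 + 4 * (?F z + ?G z)"
      unfolding fold0 by (rule tree_size_enc_binary_le)
  qed (rule ptime_binary_const)
  then show ?thesis by (simp add: fold0 horner_rev_bits)
qed

lemma ptime_binary_of_unary: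
  assumes f: "ptime E (\<lambda>z. enc_unary (f z))"
  shows "ptime E (\<lambda>z. enc_binary (f z))"
proof -
  have fold: "fold (\<lambda>_ n. n + 1) us 0 = length us" for us :: "unit list"
    by (induction us rule: rev_induct) auto
  have "ptime E (\<lambda>z. enc_binary (fold (\<lambda>_ n. n + 1) (replicate (f z) ()) 0))"
  proof (rule ptime_fold[where h="\<lambda>_ _ n. n + 1" and ey=enc_binary and a="\<lambda>_. 0"])
    show "ptime E (\<lambda>z. enc_list (\<lambda>_. Leaf) (replicate (f z) ()))"
      using f by (simp add: enc_unary_replicate)
    show "ptime (enc_pair E (enc_pair (\<lambda>_::unit. Leaf) enc_binary)) (\<lambda>p. enc_binary (snd (snd p) + 1))"
      by (rule ptime_binary_add ptime_binary_const ptime_vars)+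
    show "pbounded UNIV E (\<lambda>z. 1 + 4 * tree_size (enc_unary (f z)))"
      by (intro pbounded_intros ptime_on_size[OF f])
    fix z ys zs assume "replicate (f z) () = ys @ zs"
    then have "length ys \<le> f z" by (metis length_append length_replicate le_add1)
    then show "tree_size (enc_binary (fold (\<lambda>_ n. n + 1) ys 0)) \<le> 1 + 4 * tree_size (enc_unary (f z))"
      unfolding fold using tree_size_enc_binary_le[of "length ys" "length ys"] by simp
  qed (rule ptime_binary_const)
  then show ?thesis by (simp only: fold length_replicate)
qed

text \<open>Comparison of numbers, least significant digits first: the last digits that differ decide.\<close>

definition le_step :: "(nat \<times> nat) \<times> bool \<Rightarrow> (nat \<times> nat) \<times> bool" where
  "le_step s = ((fst (fst s) div 2, snd (fst s) div 2),
    (if odd (fst (fst s)) = odd (snd (fst s)) then snd s else odd (snd (fst s))))"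

text \<open>The loop invariant: the remaining high parts decide, and a tie falls back on the verdict
  of the digits already seen.\<close>

definition le_value :: "(nat \<times> nat) \<times> bool \<Rightarrow> bool" where
  "le_value s \<longleftrightarrow> fst (fst s) < snd (fst s) \<or> fst (fst s) = snd (fst s) \<and> snd s"

lemma le_value_step: "le_value (le_step s) = le_value s"
proof -
  obtain a b c where s: "s = ((a, b), c)" by (metis surj_pair)
  show ?thesis unfolding s le_value_def le_step_def fst_conv snd_conv
    by (cases "odd a"; cases "odd b") (auto elim!: oddE evenE, presburger)
qed

lemma fold_le_step:
  "le_value (fold (\<lambda>_. le_step) us s) = le_value s"
  "fst (fold (\<lambda>_. le_step) us s) = (fst (fst s) div 2 ^ length us, snd (fst s) div 2 ^ length us)"
  by (induction us arbitrary: s) (auto simp: le_value_step, auto simp: le_step_def div_mult2_eq)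

lemma snd_fold_le_step: "snd (fold (\<lambda>_. le_step) (bits a @ bits b) ((a, b), True)) \<longleftrightarrow> a \<le> b"
proof -
  let ?k = "length (bits a) + length (bits b)"
  have "a < 2 ^ ?k" "b < 2 ^ ?k"
    by (rule less_le_trans[OF less_two_power_length_bits power_increasing]; simp)+
  then have "fst (fold (\<lambda>_. le_step) (bits a @ bits b) ((a, b), True)) = (0, 0)"
    unfolding fold_le_step by simp
  then have "snd (fold (\<lambda>_. le_step) (bits a @ bits b) ((a, b), True)) =
      le_value (fold (\<lambda>_. le_step) (bits a @ bits b) ((a, b), True))"
    unfolding le_value_def by simp
  also have "\<dots> = le_value ((a, b), True)" by (rule fold_le_step)
  finally show ?thesis by (auto simp: le_value_def)
qed

lemma ptime_binary_le:
  assumes f: "ptime E (\<lambda>z. enc_binary (f z))" and g: "ptime E (\<lambda>z. enc_binary (g z))"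
  shows "ptime E (\<lambda>z. enc_bool (f z \<le> g z))"
proof -
  let ?e = "enc_pair (enc_pair enc_binary enc_binary) enc_bool"
  have "ptime E (\<lambda>z. ?e (fold (\<lambda>_. le_step) (bits (f z) @ bits (g z)) ((f z, g z), True)))"
  proof (rule ptime_fold_additive[where h="\<lambda>_ _. le_step" and ey="?e" and a="\<lambda>z. ((f z, g z), True)"])
    show "ptime E (\<lambda>z. enc_list enc_bool (bits (f z) @ bits (g z)))"
      using f g by (intro ptime_append) (simp_all add: enc_binary_bits)
    show "ptime E (\<lambda>z. ?e ((f z, g z), True))"
      by (intro ptime_pair f g ptime_True)
    show "ptime (enc_pair E (enc_pair enc_bool ?e)) (\<lambda>p. ?e (le_step (snd (snd p))))"
      unfolding le_step_def
      by (rule ptime_pair ptime_if[where e=enc_bool] ptime_eq[OF inj_enc_bool]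
          ptime_binary_odd ptime_binary_half ptime_vars)+
    show "tree_size (?e (le_step s)) \<le> tree_size (?e s) + 2" for s
      using tree_size_enc_binary_half[of "fst (fst s)"] tree_size_enc_binary_half[of "snd (fst s)"]
      by (auto simp: le_step_def enc_pair_def enc_bool_def)
  qed
  from ptime_snd[OF this] show ?thesis by (simp only: snd_fold_le_step)
qed

section \<open>The reduction\<close>

text \<open>A constraint as it appears in the encoding: the satisfying tuples of the predicate, the scope,
  and the numerator and denominator of the weight. An instance adds the number of variables.\<close>

type_synonym rcon = "nat list list \<times> nat list \<times> nat \<times> nat"
type_synonym rinst = "nat \<times> rcon list"

abbreviation tuples :: "nat list list \<times> nat list \<times> 'a \<Rightarrow> nat list list" where "tuples C \<equiv> fst C"
abbreviation vars :: "nat list list \<times> nat list \<times> 'a \<Rightarrow> nat list" where "vars C \<equiv> fst (snd C)"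
abbreviation num :: "rcon \<Rightarrow> nat" where "num C \<equiv> fst (snd (snd C))"
abbreviation den :: "rcon \<Rightarrow> nat" where "den C \<equiv> snd (snd (snd C))"

abbreviation "enc_tuple \<equiv> enc_list enc_unary"
abbreviation "enc_rcon \<equiv>
  enc_pair (enc_list enc_tuple) (enc_pair enc_tuple (enc_pair enc_binary enc_binary))"
abbreviation "enc_rinst \<equiv> enc_pair enc_unary (enc_list enc_rcon)"

definition sat :: "nat list \<Rightarrow> rcon \<Rightarrow> bool" where
  "sat \<chi> C \<longleftrightarrow> map (nth0 \<chi>) (vars C) \<in> set (tuples C)"

definition live :: "rinst \<Rightarrow> rcon list" where
  "live F = filter (\<lambda>C. tuples C \<noteq> [] \<and> num C \<noteq> 0) (snd F)"

locale reduction =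
  fixes L :: nat  \<comment> \<open>precision of the rounding of the weights\<close>
    and K :: nat and P :: "nat list list"  \<comment> \<open>arity and satisfying tuples of the predicate used for padding\<close>
begin

definition precision :: "rinst \<Rightarrow> nat" where
  "precision F = (length (snd F) + 1) * L"

text \<open>With \<open>w\<close> the weight of \<open>C\<close> and \<open>w'\<close> the largest weight of a live constraint, this says
  \<open>a \<le> precision F * w / w'\<close>.\<close>

definition admits :: "rinst \<Rightarrow> rcon \<Rightarrow> nat \<Rightarrow> bool" where
  "admits F C a \<longleftrightarrow>
    (\<forall>C' \<in> set (live F). a * num C' * den C \<le> precision F * num C * den C')"

text \<open>Counting the \<open>a\<close> for which \<open>admits F C (Suc a)\<close> holds yields
  the rounded-down multiplicity without programming a division. As no live weight exceeds the
  largest one, candidates up to \<open>precision F\<close> suffice.\<close>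

definition expand :: "rinst \<Rightarrow> rcon list" where
  "expand F = concat (map (\<lambda>C. map (\<lambda>_. C)
    (filter (\<lambda>a. admits F C (Suc a)) [0..<precision F])) (live F))"

definition deg :: "rinst \<Rightarrow> nat \<Rightarrow> nat" where
  "deg F i = length (filter (\<lambda>C. i \<in> set (vars C)) (expand F))"

definition offset :: "rinst \<Rightarrow> nat \<Rightarrow> nat" where
  "offset F i = (\<Sum>j\<leftarrow>[0..<i]. deg F j)"

text \<open>\<open>2 * fst F * length (expand F) * length (expand F)\<close> bounds the number of
  padding constraints. With \<open>fst F + 1\<close> the number of rounds stays positive for a
  nonempty expansion even if there are no variables.\<close>

definition rounds :: "rinst \<Rightarrow> nat" where
  "rounds F = 2 * (fst F + 1) * length (expand F) * length (expand F)"

text \<open>Variable \<open>i\<close> is split into \<open>deg F i\<close> groups of \<open>K\<close> copies; round \<open>t\<close> uses group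
  \<open>t mod deg F i\<close>.\<close>

definition copy_of :: "rinst \<Rightarrow> nat \<Rightarrow> nat \<Rightarrow> nat \<Rightarrow> nat" where
  "copy_of F t j i = K * (offset F i + t mod deg F i) + j"

definition main :: "rinst \<Rightarrow> (nat list list \<times> nat list) list" where
  "main F = concat (map (\<lambda>t. concat (map (\<lambda>j.
    map (\<lambda>C. (tuples C, map (copy_of F t j) (vars C))) (expand F)) [0..<K])) [0..<rounds F])"

definition uses :: "rinst \<Rightarrow> nat \<Rightarrow> nat \<Rightarrow> nat" where
  "uses F i c = length (filter (\<lambda>t. t mod deg F i = c) [0..<rounds F])"

text \<open>The degree aimed at is \<open>rounds F + length (expand F)\<close>, the same for all
  copies. It is at least the degree of any copy in \<open>main F\<close>, so the truncated
  subtraction is exact.\<close>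

definition deficit :: "rinst \<Rightarrow> nat \<Rightarrow> nat \<Rightarrow> nat" where
  "deficit F i c = (rounds F + length (expand F)) - deg F i * uses F i c"

definition pads :: "rinst \<Rightarrow> (nat list list \<times> nat list) list" where
  "pads F = concat (map (\<lambda>i. concat (map (\<lambda>c.
    map (\<lambda>_. (P, map (\<lambda>j. K * (offset F i + c) + j) [0..<K])) [0..<deficit F i c])
    [0..<deg F i])) [0..<fst F])"

text \<open>Weights must sum to 1, so an instance cannot be without constraints; if nothing is
  expanded, a fixed legal instance stands in. The common weight is written as 1 over the number of
  constraints, which is already in lowest terms.\<close>

definition regularized :: "rinst \<Rightarrow> rinst" where
  "regularized F =
    (if expand F = [] then (K, [(P, [0..<K], 1, 1)])
     else (K * offset F (fst F),
       map (\<lambda>C. (fst C, snd C, 1, length (main F @ pads F))) (main F @ pads F)))"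

definition score :: "rinst \<Rightarrow> nat list \<Rightarrow> nat" where
  "score F \<chi> = length (filter (sat \<chi>) (expand F))"

definition candidate :: "rinst \<Rightarrow> nat list \<Rightarrow> nat \<Rightarrow> nat \<Rightarrow> nat list" where
  "candidate F X t j = map (\<lambda>i. nth0 X (copy_of F t j i)) [0..<fst F]"

text \<open>The zero assignment keeps the list nonempty on every input, even without rounds, so that
  the \<open>hd\<close> in \<open>decode\<close> is always specified.\<close>

definition candidates :: "rinst \<Rightarrow> nat list \<Rightarrow> nat list list" where
  "candidates F X = map (\<lambda>_. 0) [0..<fst F] #
    concat (map (\<lambda>t. map (candidate F X t) [0..<K]) [0..<rounds F])"

definition decode :: "rinst \<Rightarrow> nat list \<Rightarrow> nat list" where
  "decode F X = hd (filter (\<lambda>\<chi>. \<forall>\<chi>' \<in> set (candidates F X). score F \<chi>' \<le> score F \<chi>)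
    (candidates F X))"

lemma best_candidate:
  "filter (\<lambda>\<chi>. \<forall>\<chi>' \<in> set (candidates F X). score F \<chi>' \<le> score F \<chi>) (candidates F X) \<noteq> []"
proof -
  have "candidates F X \<noteq> []" by (simp add: candidates_def)
  then have "Max (score F ` set (candidates F X)) \<in> score F ` set (candidates F X)"
    by (intro Max_in) auto
  then obtain \<chi> where "\<chi> \<in> set (candidates F X)" "score F \<chi> = Max (score F ` set (candidates F X))"
    by (metis imageE)
  then show ?thesis by (auto simp: filter_empty_conv intro!: bexI[of _ \<chi>])
qed

lemma decode_in_candidates: "decode F X \<in> set (candidates F X)"
  and decode_best: "\<chi> \<in> set (candidates F X) \<Longrightarrow> score F \<chi> \<le> score F (decode F X)"
  using hd_in_set[OF best_candidate, of F X] unfolding decode_def[symmetric] by auto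


subsection \<open>Running time\<close>

text \<open>Running times are proved by following the syntax of a definition, with one rule per
  operation. Each function below is unfolded once, on a closed argument; afterwards a composition
  rule for it is used.\<close>

lemmas ptime_rules = ptime_unary_const ptime_binary_const ptime_Nil ptime_pair
  ptime_not ptime_conj ptime_null ptime_Cons ptime_concat ptime_append ptime_upt ptime_map ptime_filter ptime_all
  ptime_eq[OF inj_enc_unary] ptime_member[OF inj_enc_unary] ptime_member[OF inj_enc_list[OF inj_enc_unary]]
  ptime_length ptime_sum_list
  ptime_unary_Suc ptime_unary_add ptime_unary_mult ptime_unary_diff ptime_unary_mod
  ptime_binary_mult ptime_binary_zero ptime_nth0

lemma ptime_sat_closed: "ptime (enc_pair enc_tuple enc_rcon) (\<lambda>p. enc_bool (sat (fst p) (snd p)))"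
  unfolding sat_def by (rule ptime_rules ptime_vars)+

lemmas ptime_sat = ptime_comp2[where g="\<lambda>a b. enc_bool (sat a b)", OF ptime_sat_closed]

lemma ptime_live_closed: "ptime enc_rinst (\<lambda>F. enc_list enc_rcon (live F))"
  unfolding live_def by (rule ptime_rules ptime_vars)+

lemmas ptime_live = ptime_comp[OF ptime_live_closed]

lemma ptime_precision:
  "ptime E (\<lambda>z. enc_rinst (F z)) \<Longrightarrow> ptime E (\<lambda>z. enc_unary (precision (F z)))"
  unfolding precision_def by (rule ptime_rules ptime_vars | assumption)+

text \<open>Numerators and denominators may be exponential in the input size, so the unary factors
  are converted to binary before multiplying.\<close>

lemma ptime_admits_closed:
  "ptime (enc_pair (enc_pair enc_rinst enc_rcon) enc_unary)
    (\<lambda>p. enc_bool (admits (fst (fst p)) (snd (fst p)) (snd p)))"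
proof -
  let ?E = "enc_pair (enc_pair (enc_pair enc_rinst enc_rcon) enc_unary) enc_rcon"
  have a: "ptime ?E (\<lambda>p. enc_binary (snd (fst p)))"
    by (rule ptime_binary_of_unary) (rule ptime_vars)+
  have b: "ptime ?E (\<lambda>p. enc_binary (precision (fst (fst (fst p)))))"
    by (rule ptime_binary_of_unary, rule ptime_precision) (rule ptime_vars)+
  show ?thesis
    unfolding admits_def by (rule a b ptime_binary_le ptime_rules ptime_live ptime_vars)+
qed

lemma ptime_admits:
  "ptime E (\<lambda>z. enc_rinst (F z)) \<Longrightarrow> ptime E (\<lambda>z. enc_rcon (C z)) \<Longrightarrow> ptime E (\<lambda>z. enc_unary (a z)) \<Longrightarrow>
    ptime E (\<lambda>z. enc_bool (admits (F z) (C z) (a z)))"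
  using ptime_comp[OF ptime_admits_closed, of E "\<lambda>z. ((F z, C z), a z)"]
  by (simp add: ptime_pair)

lemma ptime_expand_closed: "ptime enc_rinst (\<lambda>F. enc_list enc_rcon (expand F))"
  unfolding expand_def
  by (rule ptime_admits ptime_precision ptime_live ptime_rules ptime_vars)+

lemmas ptime_expand = ptime_comp[OF ptime_expand_closed]

lemma ptime_deg_closed: "ptime (enc_pair enc_rinst enc_unary) (\<lambda>p. enc_unary (deg (fst p) (snd p)))"
  unfolding deg_def by (rule ptime_expand ptime_rules ptime_vars)+

lemmas ptime_deg = ptime_comp2[where g="\<lambda>F i. enc_unary (deg F i)", OF ptime_deg_closed]

lemma ptime_offset_closed: "ptime (enc_pair enc_rinst enc_unary) (\<lambda>p. enc_unary (offset (fst p) (snd p)))"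
  unfolding offset_def by (rule ptime_deg ptime_rules ptime_vars)+

lemmas ptime_offset = ptime_comp2[where g="\<lambda>F i. enc_unary (offset F i)", OF ptime_offset_closed]

lemma ptime_rounds_closed: "ptime enc_rinst (\<lambda>F. enc_unary (rounds F))"
  unfolding rounds_def by (rule ptime_expand ptime_rules ptime_vars)+

lemmas ptime_rounds = ptime_comp[OF ptime_rounds_closed]

lemma ptime_copy_of_closed:
  "ptime (enc_pair (enc_pair enc_rinst enc_unary) (enc_pair enc_unary enc_unary))
    (\<lambda>p. enc_unary (copy_of (fst (fst p)) (snd (fst p)) (fst (snd p)) (snd (snd p))))"
  unfolding copy_of_def by (rule ptime_deg ptime_offset ptime_rules ptime_vars)+

lemma ptime_copy_of:
  "ptime E (\<lambda>z. enc_rinst (F z)) \<Longrightarrow> ptime E (\<lambda>z. enc_unary (t z)) \<Longrightarrow> ptime E (\<lambda>z. enc_unary (j z)) \<Longrightarrow>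
    ptime E (\<lambda>z. enc_unary (i z)) \<Longrightarrow> ptime E (\<lambda>z. enc_unary (copy_of (F z) (t z) (j z) (i z)))"
  using ptime_comp[OF ptime_copy_of_closed, of E "\<lambda>z. ((F z, t z), (j z, i z))"]
  by (simp add: ptime_pair)

lemma ptime_main_closed:
  "ptime enc_rinst (\<lambda>F. enc_list (enc_pair (enc_list enc_tuple) enc_tuple) (main F))"
  unfolding main_def
  by (rule ptime_copy_of ptime_expand ptime_rounds ptime_rules ptime_vars)+

lemmas ptime_main = ptime_comp[OF ptime_main_closed]

lemma ptime_deficit_closed:
  "ptime (enc_pair enc_rinst (enc_pair enc_unary enc_unary))
    (\<lambda>p. enc_unary (deficit (fst p) (fst (snd p)) (snd (snd p))))"
  unfolding deficit_def uses_def
  by (rule ptime_deg ptime_expand ptime_rounds ptime_rules ptime_vars)+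

lemma ptime_deficit:
  "ptime E (\<lambda>z. enc_rinst (F z)) \<Longrightarrow> ptime E (\<lambda>z. enc_unary (i z)) \<Longrightarrow> ptime E (\<lambda>z. enc_unary (c z)) \<Longrightarrow>
    ptime E (\<lambda>z. enc_unary (deficit (F z) (i z) (c z)))"
  using ptime_comp[OF ptime_deficit_closed, of E "\<lambda>z. (F z, (i z, c z))"]
  by (simp add: ptime_pair)

lemma ptime_tuples_const: "ptime E (\<lambda>_. enc_list enc_tuple P)"
  by (rule ptime_on_const)

lemma ptime_pads_closed:
  "ptime enc_rinst (\<lambda>F. enc_list (enc_pair (enc_list enc_tuple) enc_tuple) (pads F))"
  unfolding pads_def
  by (rule ptime_tuples_const ptime_deficit ptime_deg ptime_offset ptime_rules ptime_vars)+

lemmas ptime_pads = ptime_comp[OF ptime_pads_closed]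

lemma ptime_regularized: "ptime enc_rinst (\<lambda>F. enc_rinst (regularized F))"
proof -
  have 1: "ptime enc_rinst (\<lambda>F. enc_rinst (K, [(P, [0..<K], 1, 1)]))"
    by (rule ptime_on_const)
  have len: "ptime (enc_pair enc_rinst (enc_pair (enc_list enc_tuple) enc_tuple))
      (\<lambda>p. enc_binary (length (main (fst p) @ pads (fst p))))"
    by (rule ptime_binary_of_unary) (rule ptime_length ptime_append ptime_main ptime_pads ptime_vars)+
  have 2: "ptime enc_rinst (\<lambda>F. enc_rinst (K * offset F (fst F),
       map (\<lambda>C. (fst C, snd C, 1, length (main F @ pads F))) (main F @ pads F)))"
    by (rule len ptime_main ptime_pads ptime_offset ptime_rules ptime_vars)+
  show ?thesis
    unfolding regularized_def
    by (rule ptime_if[where e=enc_rinst, OF _ 1 2]) (rule ptime_null ptime_expand ptime_vars)+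
qed

lemma ptime_score_closed: "ptime (enc_pair enc_rinst enc_tuple) (\<lambda>p. enc_unary (score (fst p) (snd p)))"
  unfolding score_def by (rule ptime_sat ptime_expand ptime_rules ptime_vars)+

lemmas ptime_score = ptime_comp2[where g="\<lambda>F i. enc_unary (score F i)", OF ptime_score_closed]

lemma ptime_candidates_closed:
  "ptime (enc_pair enc_rinst enc_tuple) (\<lambda>p. enc_list enc_tuple (candidates (fst p) (snd p)))"
  unfolding candidates_def candidate_def
  by (rule ptime_copy_of ptime_rounds ptime_rules ptime_vars)+

lemmas ptime_candidates = ptime_comp2[where g="\<lambda>F X. enc_list enc_tuple (candidates F X)", OF ptime_candidates_closed]

lemma ptime_decode: "ptime (enc_pair enc_rinst enc_tuple) (\<lambda>p. enc_tuple (decode (fst p) (snd p)))"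
  unfolding decode_def
  by (rule ptime_hd[OF _ best_candidate])
     (rule ptime_candidates ptime_score ptime_unary_le ptime_rules ptime_vars)+

end

subsection \<open>Counting\<close>

lemma length_filter_concat_upt:
  "length (filter Q (concat (map f [0..<n]))) = (\<Sum>x<n. length (filter Q (f x)))"
  by (induction n) auto

lemma length_concat_upt: "length (concat (map f [0..<n])) = (\<Sum>x<n. length (f x))"
  using length_filter_concat_upt[of "\<lambda>_. True" f n] by simp

text \<open>Shifting by \<open>d - 1 - c\<close> moves the hits to the ends of blocks of length
  \<open>d\<close>, so that the completed blocks are counted.\<close>

lemma length_filter_mod_upt:
  assumes "c < d"
  shows "length (filter (\<lambda>t. t mod d = c) [0..<n]) = (n + (d - 1 - c)) div d"
proof (induction n)
  case 0
  then show ?case using assms by simp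
next
  case (Suc n)
  have "Suc (n + (d - 1 - c)) mod d = 0 \<longleftrightarrow> n mod d = c"
  proof -
    have "Suc (n + (d - 1 - c)) = n + (d - c)" using assms by simp
    then have "Suc (n + (d - 1 - c)) mod d = (n mod d + (d - c)) mod d"
      by (simp only: mod_add_left_eq)
    moreover have "(r + (d - c)) mod d = 0 \<longleftrightarrow> r = c" if "r < d" for r
    proof (cases "r < c")
      case False
      then have "r + (d - c) = d + (r - c)" using assms by simp
      then have "(r + (d - c)) mod d = r - c"
        using that by (metis mod_add_self1 mod_less less_imp_diff_less)
      then show ?thesis using False by simp
    qed (use assms in simp)
    ultimately show ?thesis using assms by simp
  qed
  then show ?case using Suc by (simp add: div_Suc)
qed

lemma length_filter_mod_upt_bounds:
  assumes "c < d"
  shows "d * length (filter (\<lambda>t. t mod d = c) [0..<n]) \<le> n + d"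
    and "n \<le> d * length (filter (\<lambda>t. t mod d = c) [0..<n]) + d"
proof -
  let ?m = "n + (d - 1 - c)"
  have "d * (?m div d) + ?m mod d = ?m" "?m mod d < d" using assms by simp_all
  then show "d * length (filter (\<lambda>t. t mod d = c) [0..<n]) \<le> n + d"
    and "n \<le> d * length (filter (\<lambda>t. t mod d = c) [0..<n]) + d"
    unfolding length_filter_mod_upt[OF assms] using assms by linarith+
qed

lemma length_filter_Suc_le:
  fixes x :: real
  assumes "0 \<le> x" "x \<le> real n"
  shows "real (length (filter (\<lambda>a. real (Suc a) \<le> x) [0..<n])) = real_of_int \<lfloor>x\<rfloor>"
proof -
  have k: "nat \<lfloor>x\<rfloor> \<le> n" using assms by linarith
  have "filter (\<lambda>a. real (Suc a) \<le> x) [0..<n] = filter (\<lambda>a. a < nat \<lfloor>x\<rfloor>) [0..<n]"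
    using assms by (intro filter_cong) (auto, linarith+)
  also have "\<dots> = [0..<nat \<lfloor>x\<rfloor>]"
  proof -
    have "[0..<n] = [0..<nat \<lfloor>x\<rfloor>] @ [nat \<lfloor>x\<rfloor>..<n]" using k by (metis le0 le_Suc_ex upt_add_eq_append)
    then show ?thesis by (simp add: filter_id_conv filter_empty_conv)
  qed
  finally show ?thesis using assms by simp
qed


subsection \<open>Instances and their encodings\<close>

definition wt :: "rcon \<Rightarrow> real" where
  "wt C = real (num C) / real (den C)"

definition rval :: "nat list \<Rightarrow> rinst \<Rightarrow> real" where
  "rval \<chi> F = (\<Sum>C\<leftarrow>snd F. wt C * of_bool (sat \<chi> C))"

definition wf :: "nat \<Rightarrow> rinst \<Rightarrow> bool" where
  "wf q F \<longleftrightarrow> (\<forall>C \<in> set (snd F). distinct (vars C) \<and> set (vars C) \<subseteq> {..<fst F} \<and> 0 < den C \<and>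
    (\<forall>\<tau> \<in> set (tuples C). length \<tau> = length (vars C) \<and> set \<tau> \<subseteq> {..<q}))"

definition sat_tuples :: "nat \<Rightarrow> predicate \<Rightarrow> nat list list" where
  "sat_tuples q Q = filter (holds Q) (List.n_lists (arity Q) [0..<q])"

definition raw_con :: "nat \<Rightarrow> constraint \<Rightarrow> rcon" where
  "raw_con q C = (sat_tuples q (pred C), scope C,
    nat (fst (quotient_of (weight C))), nat (snd (quotient_of (weight C))))"

definition raw :: "nat \<Rightarrow> csp_instance \<Rightarrow> rinst" where
  "raw q F = (nvars F, map (raw_con q) (constraints F))"

lemma enc_list_map: "enc_list e (map f xs) = enc_list (\<lambda>x. e (f x)) xs"
  by (induction xs) auto

text \<open>The encoding factors through \<open>raw\<close>: a program sees nothing of an instance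
  beyond its raw form. This justifies working with \<open>rinst\<close> throughout.\<close>

lemma enc_instance_raw: "enc_instance q F = enc_rinst (raw q F)"
  by (simp add: enc_instance_def raw_def enc_pair_def enc_list_map enc_constraint_def[abs_def]
      enc_predicate_def enc_rat_def raw_con_def sat_tuples_def case_prod_beta)

lemma wt_raw_con: "weight C \<ge> 0 \<Longrightarrow> wt (raw_con q C) = of_rat (weight C)"
proof -
  assume w: "weight C \<ge> 0"
  obtain a b where ab: "quotient_of (weight C) = (a, b)" by (metis surj_pair)
  have "b > 0" using quotient_of_denom_pos[OF ab] .
  have eq: "weight C = of_int a / of_int b" using quotient_of_div[OF ab] .
  with w \<open>b > 0\<close> have "a \<ge> 0" by (simp add: zero_le_divide_iff)
  then have "wt (raw_con q C) = real_of_int a / real_of_int b"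
    using \<open>b > 0\<close> by (simp add: wt_def raw_con_def ab)
  then show ?thesis unfolding eq by (simp add: of_rat_divide)
qed

lemma sat_tuples_iff: "\<tau> \<in> set (sat_tuples q Q) \<longleftrightarrow> holds Q \<tau> \<and> length \<tau> = arity Q \<and> set \<tau> \<subseteq> {..<q}"
  by (auto simp: sat_tuples_def set_n_lists)

lemma Val_raw:
  assumes "F \<in> weighted_instances \<Lambda>" "\<chi> \<in> assignments q F"
  shows "Val \<chi> F = rval \<chi> (raw q F)"
proof -
  have "of_rat (weight C) * of_bool (holds (pred C) (map (\<lambda>x. \<chi> ! x) (scope C))) =
      wt (raw_con q C) * of_bool (sat \<chi> (raw_con q C))" if C: "C \<in> set (constraints F)" for C
  proof -
    have s: "length (scope C) = arity (pred C)" "set (scope C) \<subseteq> {..<length \<chi>}" "weight C \<ge> 0"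
      using assms C by (auto simp: weighted_instances_def assignments_def)
    then have m: "map (nth0 \<chi>) (scope C) = map (\<lambda>x. \<chi> ! x) (scope C)"
      by (auto simp: nth0_def)
    have "set (map (\<lambda>x. \<chi> ! x) (scope C)) \<subseteq> {..<q}"
    proof
      fix y assume "y \<in> set (map (\<lambda>x. \<chi> ! x) (scope C))"
      then obtain x where "x < length \<chi>" "y = \<chi> ! x" using s by auto
      then show "y \<in> {..<q}" using assms(2) nth_mem[of x \<chi>] by (auto simp: assignments_def simp del: nth_mem)
    qed
    then have "sat \<chi> (raw_con q C) \<longleftrightarrow> holds (pred C) (map (\<lambda>x. \<chi> ! x) (scope C))"
      unfolding sat_def raw_con_def fst_conv snd_conv m sat_tuples_iff using s by simp
    then show ?thesis using wt_raw_con s by simp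
  qed
  then have "map (\<lambda>C. of_rat (weight C) * of_bool (holds (pred C) (map (\<lambda>x. \<chi> ! x) (scope C)))) (constraints F)
      = map (\<lambda>C. wt (raw_con q C) * of_bool (sat \<chi> (raw_con q C))) (constraints F)"
    by simp
  then show ?thesis unfolding Val_def rval_def raw_def snd_conv map_map comp_def by (rule arg_cong)
qed

lemma wf_raw:
  assumes "F \<in> weighted_instances \<Lambda>"
  shows "wf q (raw q F)"
  using assms
  by (auto simp: wf_def raw_def raw_con_def weighted_instances_def sat_tuples_iff quotient_of_denom_pos' subset_iff)

lemma finite_assignments: "finite (assignments q F)"
  using finite_lists_length_eq[of "{..<q}" "nvars F"] by (simp add: assignments_def conj_commute)

lemma Val_le_Opt: "\<chi> \<in> assignments q F \<Longrightarrow> Val \<chi> F \<le> Opt q F"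
  unfolding Opt_def by (intro Max_ge) (auto simp: finite_assignments)

lemma Opt_attained:
  assumes "0 < q"
  obtains \<chi> where "\<chi> \<in> assignments q F" "Val \<chi> F = Opt q F"
proof -
  have "replicate (nvars F) 0 \<in> assignments q F"
    using assms by (auto simp: assignments_def)
  then have "Opt q F \<in> (\<lambda>\<chi>. Val \<chi> F) ` assignments q F"
    unfolding Opt_def by (intro Max_in) (auto simp: finite_assignments)
  then show ?thesis using that by auto
qed

text \<open>A raw constraint forgets its predicate, and any member of \<open>\<Lambda>\<close> with
  the same arity and tuples can be put back. The arity is required separately because an empty list
  of tuples does not reveal it. This choice is no algorithmic step: a program only produces the
  encoding.\<close>

lemma unweighted_regular_instance_of_raw:
  assumes ne: "snd R \<noteq> []"
    and C: "\<And>C. C \<in> set (snd R) \<Longrightarrow> (\<exists>Q\<in>\<Lambda>. arity Q = length (vars C) \<and> sat_tuples q Q = tuples C) \<and>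
      distinct (vars C) \<and> set (vars C) \<subseteq> {..<fst R} \<and> num C = 1 \<and> den C = length (snd R)"
    and d: "\<And>v. v < fst R \<Longrightarrow> length (filter (\<lambda>C. v \<in> set (vars C)) (snd R)) = d"
  shows "\<exists>G \<in> unweighted_regular_instances \<Lambda>. raw q G = R"
proof -
  let ?m = "length (snd R)"
  define pick where "pick C = (SOME Q. Q \<in> \<Lambda> \<and> arity Q = length (vars C) \<and> sat_tuples q Q = tuples C)"
    for C :: rcon
  have pick: "pick C \<in> \<Lambda> \<and> arity (pick C) = length (vars C) \<and> sat_tuples q (pick C) = tuples C"
    if "C \<in> set (snd R)" for C
    unfolding pick_def by (rule someI_ex) (use assms(2)[OF that] in blast)
  define lift where "lift C = \<lparr>pred = pick C, scope = vars C, weight = 1 / of_nat ?m\<rparr>" for C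
  define G where "G = \<lparr>nvars = fst R, constraints = map lift (snd R)\<rparr>"
  have "quotient_of (1 / of_nat ?m) = (1, int ?m)"
    using ne quotient_of_Fract[of 1 "int ?m"]
    by (simp add: Fract_of_int_quotient normalize_def Let_def)
  then have "raw_con q (lift C) = C" if "C \<in> set (snd R)" for C
    using pick[OF that] C[OF that] by (simp add: raw_con_def lift_def prod_eq_iff)
  then have "map (raw_con q \<circ> lift) (snd R) = snd R" by (intro map_idI) simp
  then have raw: "raw q G = R" by (simp add: raw_def G_def prod_eq_iff)
  have "sum_list (map (\<lambda>x. 1 / of_nat ?m :: rat) (snd R)) = 1"
    using ne by (simp add: map_replicate_const sum_list_replicate)
  then have sum: "(\<Sum>C\<leftarrow>constraints G. weight C) = 1"
    by (simp add: G_def lift_def comp_def)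
  have "G \<in> weighted_instances \<Lambda>"
    unfolding weighted_instances_def using sum pick C by (auto simp: G_def lift_def)
  moreover have "unweighted G" by (auto simp: unweighted_def G_def lift_def)
  moreover have "regular G" unfolding regular_def degree_of_def
    using d by (intro exI[of _ d]) (simp add: G_def lift_def filter_map comp_def)
  ultimately show ?thesis using raw by (auto simp: unweighted_regular_instances_def)
qed

lemma rval_uniform:
  assumes "\<And>C. C \<in> set (snd R) \<Longrightarrow> num C = 1 \<and> den C = length (snd R)"
  shows "rval \<chi> R = real (length (filter (sat \<chi>) (snd R))) / real (length (snd R))"
proof -
  have "map (\<lambda>C. wt C * of_bool (sat \<chi> C)) (snd R) =
      map (\<lambda>C. 1 / real (length (snd R)) * of_bool (sat \<chi> C)) (snd R)"
    using assms by (simp add: wt_def)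
  then have "rval \<chi> R = 1 / real (length (snd R)) * (\<Sum>C\<leftarrow>snd R. of_bool (sat \<chi> C))"
    unfolding rval_def by (simp only: sum_list_const_mult)
  moreover have "(\<Sum>C\<leftarrow>Cs. of_bool (sat \<chi> C)) = real (length (filter (sat \<chi>) Cs))" for Cs
    by (induction Cs) auto
  ultimately show ?thesis by simp
qed

text \<open>Place a satisfying tuple on the distinct variables of the constraint and 0 elsewhere.
  For the heaviest live constraint this gives \<open>W \<le> Opt\<close>, against which all losses
  are measured.\<close>

lemma weight_le_rval_attained:
  assumes wf: "wf q F" and q: "0 < q" and C: "C \<in> set (live F)"
  obtains \<chi> where "length \<chi> = fst F" "set \<chi> \<subseteq> {..<q}" "wt C \<le> rval \<chi> F"
proof -
  have C': "C \<in> set (snd F)" "tuples C \<noteq> []" using C by (auto simp: live_def)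
  then obtain \<tau> where \<tau>: "\<tau> \<in> set (tuples C)" by (meson last_in_set)
  have v: "distinct (vars C)" "set (vars C) \<subseteq> {..<fst F}" "length \<tau> = length (vars C)" "set \<tau> \<subseteq> {..<q}"
    using wf C' \<tau> by (auto simp: wf_def)
  define m where "m = map_of (zip (vars C) \<tau>)"
  define \<chi> where "\<chi> = map (\<lambda>x. case m x of None \<Rightarrow> 0 | Some y \<Rightarrow> y) [0..<fst F]"
  have mv: "m (vars C ! k) = Some (\<tau> ! k)" if "k < length (vars C)" for k
    unfolding m_def using v that by (simp add: map_of_zip_nth)
  have "map (nth0 \<chi>) (vars C) = \<tau>"
  proof (rule nth_equalityI)
    fix k assume "k < length (map (nth0 \<chi>) (vars C))"
    then have k: "k < length (vars C)" by simp
    then have "vars C ! k < fst F" using v(2) nth_mem[OF k] by (auto simp del: nth_mem)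
    then show "map (nth0 \<chi>) (vars C) ! k = \<tau> ! k" using k mv[OF k] by (simp add: nth0_def \<chi>_def)
  qed (use v in simp)
  then have sat: "sat \<chi> C" using \<tau> by (simp add: sat_def)
  have "wt C = wt C * of_bool (sat \<chi> C)" using sat by simp
  also have "\<dots> \<le> rval \<chi> F" unfolding rval_def
    by (rule member_le_sum_list) (use C' in \<open>auto simp: wt_def\<close>)
  finally have "wt C \<le> rval \<chi> F" .
  moreover have "set \<chi> \<subseteq> {..<q}"
  proof -
    have "y < q" if "m x = Some y" for x y
      using that v(4) by (auto simp: m_def dest!: map_of_SomeD set_zip_rightD)
    then show ?thesis using q by (auto simp: \<chi>_def split: option.split)
  qed
  ultimately show ?thesis using that[of \<chi>] by (simp add: \<chi>_def)
qed

lemma set_live: "C \<in> set (live F) \<Longrightarrow> C \<in> set (snd F)"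
  by (simp add: live_def)

lemma rval_live: "rval \<chi> F = (\<Sum>C\<leftarrow>live F. wt C * of_bool (sat \<chi> C))"
proof -
  have "(\<Sum>C\<leftarrow>Cs. wt C * of_bool (sat \<chi> C)) =
      (\<Sum>C\<leftarrow>filter (\<lambda>C. tuples C \<noteq> [] \<and> num C \<noteq> 0) Cs. wt C * of_bool (sat \<chi> C))" for Cs
    by (induction Cs) (auto simp: wt_def sat_def)
  then show ?thesis by (simp add: rval_def live_def)
qed

context reduction begin

subsection \<open>Rounding the weights\<close>

lemma score_eq_sum:
  "score F \<chi> = (\<Sum>C\<leftarrow>live F. of_bool (sat \<chi> C) *
    length (filter (\<lambda>a. admits F C (Suc a)) [0..<precision F]))"
proof -
  have "length (filter (sat \<chi>) (concat (map (\<lambda>C. map (\<lambda>_. C) (f C)) Cs))) =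
      (\<Sum>C\<leftarrow>Cs. of_bool (sat \<chi> C) * length (f C))" for f :: "rcon \<Rightarrow> nat list" and Cs
    by (induction Cs) (auto simp: filter_map comp_def)
  then show ?thesis by (simp add: score_def expand_def)
qed

context
  fixes q F W
  assumes wf: "wf q F" and live: "live F \<noteq> []" and L: "0 < L"
    and W: "W = Max (wt ` set (live F))"
begin

lemma wt_live: "C \<in> set (live F) \<Longrightarrow> 0 < wt C \<and> wt C \<le> W \<and> 0 < den C"
  using wf by (auto simp: W live_def wf_def wt_def)

lemma W_attained: "\<exists>C \<in> set (live F). wt C = W"
proof -
  have "W \<in> wt ` set (live F)" unfolding W by (rule Max_in) (use live in auto)
  then show ?thesis by auto
qed

lemma W_pos: "0 < W"
  using W_attained wt_live by auto

lemma admits_iff: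
  assumes C: "C \<in> set (live F)"
  shows "admits F C a \<longleftrightarrow> real a \<le> real (precision F) * wt C / W"
proof -
  have "a * num C' * den C \<le> precision F * num C * den C' \<longleftrightarrow> real a * wt C' \<le> real (precision F) * wt C"
    if "C' \<in> set (live F)" for C'
  proof -
    have "a * num C' * den C \<le> precision F * num C * den C' \<longleftrightarrow>
        real (a * num C' * den C) \<le> real (precision F * num C * den C')" by (rule of_nat_le_iff[symmetric])
    also have "\<dots> \<longleftrightarrow> real a * wt C' \<le> real (precision F) * wt C"
      using wt_live[OF C] wt_live[OF that] by (simp add: wt_def field_simps)
    finally show ?thesis .
  qed
  then have "admits F C a \<longleftrightarrow> (\<forall>C' \<in> set (live F). real a * wt C' \<le> real (precision F) * wt C)"
    by (simp add: admits_def)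
  also have "\<dots> \<longleftrightarrow> real a * W \<le> real (precision F) * wt C"
  proof
    show "real a * W \<le> real (precision F) * wt C"
      if "\<forall>C' \<in> set (live F). real a * wt C' \<le> real (precision F) * wt C"
      using W_attained that by auto
    show "\<forall>C' \<in> set (live F). real a * wt C' \<le> real (precision F) * wt C"
      if "real a * W \<le> real (precision F) * wt C"
    proof
      fix C' assume "C' \<in> set (live F)"
      then have "real a * wt C' \<le> real a * W" using wt_live[of C'] by (intro mult_left_mono) auto
      then show "real a * wt C' \<le> real (precision F) * wt C" using that by linarith
    qed
  qed
  finally show ?thesis using W_pos by (simp add: field_simps)
qed

lemma multiplicity_bounds:
  assumes C: "C \<in> set (live F)"
  defines "a \<equiv> length (filter (\<lambda>a. admits F C (Suc a)) [0..<precision F])"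
  shows "W * real a \<le> real (precision F) * wt C" "real (precision F) * wt C \<le> W * real a + W"
proof -
  let ?x = "real (precision F) * wt C / W"
  have "?x \<le> real (precision F)"
    using wt_live[OF C] W_pos by (simp add: divide_le_eq mult_left_mono)
  moreover have "0 \<le> ?x" using wt_live[OF C] W_pos by simp
  ultimately have "real a = real_of_int \<lfloor>?x\<rfloor>"
    unfolding a_def admits_iff[OF C] by (rule length_filter_Suc_le[rotated])
  then have "real a \<le> ?x" "?x \<le> real a + 1" by linarith+
  then show "W * real a \<le> real (precision F) * wt C" "real (precision F) * wt C \<le> W * real a + W"
    using W_pos by (simp_all add: field_simps)
qed

text \<open>Up to the factor \<open>W / precision F\<close>, the score approximates the value from
  below. Rounding loses at most one unit per constraint.\<close>

lemma score_bounds: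
  "W * real (score F \<chi>) \<le> real (precision F) * rval \<chi> F"
  "real (precision F) * rval \<chi> F \<le> W * (real (score F \<chi>) + real (length (snd F)))"
proof -
  define a where "a C = length (filter (\<lambda>a. admits F C (Suc a)) [0..<precision F])" for C
  have s: "W * real (score F \<chi>) = (\<Sum>C\<leftarrow>live F. W * real (a C) * of_bool (sat \<chi> C))"
  proof -
    have "W * real (\<Sum>C\<leftarrow>Cs. of_bool (sat \<chi> C) * a C) = (\<Sum>C\<leftarrow>Cs. W * real (a C) * of_bool (sat \<chi> C))" for Cs
      by (induction Cs) (auto simp: algebra_simps)
    then show ?thesis unfolding score_eq_sum a_def .
  qed
  have r: "real (precision F) * rval \<chi> F = (\<Sum>C\<leftarrow>live F. real (precision F) * wt C * of_bool (sat \<chi> C))"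
  proof -
    have "real (precision F) * (\<Sum>C\<leftarrow>Cs. wt C * of_bool (sat \<chi> C)) =
        (\<Sum>C\<leftarrow>Cs. real (precision F) * wt C * of_bool (sat \<chi> C))" for Cs
      by (induction Cs) (auto simp: algebra_simps)
    then show ?thesis unfolding rval_live .
  qed
  show "W * real (score F \<chi>) \<le> real (precision F) * rval \<chi> F"
    unfolding s r using multiplicity_bounds by (intro sum_list_mono) (auto simp: a_def)
  have "real (precision F) * rval \<chi> F \<le> (\<Sum>C\<leftarrow>live F. W * real (a C) * of_bool (sat \<chi> C) + W)"
    unfolding r using multiplicity_bounds W_pos by (intro sum_list_mono) (auto simp: a_def)
  also have "\<dots> = W * real (score F \<chi>) + real (length (live F)) * W"
    unfolding s by (simp add: sum_list_addf sum_list_triv)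
  also have "\<dots> \<le> W * real (score F \<chi>) + real (length (snd F)) * W"
    using W_pos by (simp add: live_def)
  finally show "real (precision F) * rval \<chi> F \<le> W * (real (score F \<chi>) + real (length (snd F)))"
    by (simp add: algebra_simps)
qed

lemma expand_nonempty: "expand F \<noteq> []"
proof -
  obtain C where C: "C \<in> set (live F)" "wt C = W" using W_attained by blast
  have "0 < precision F" using L by (simp add: precision_def)
  moreover have "admits F C (Suc 0)"
    unfolding admits_iff[OF C(1)] using C W_pos \<open>0 < precision F\<close> by simp
  ultimately have "C \<in> set (expand F)" using C
    by (auto simp: expand_def intro!: bexI[of _ C])
  then show ?thesis by auto
qed

end

subsection \<open>The regular instance\<close>

lemma offset_Suc: "offset F (Suc i) = offset F i + deg F i"
  by (simp add: offset_def)

lemma offset_mono: "i \<le> i' \<Longrightarrow> offset F i \<le> offset F i'"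
  by (induction i' rule: dec_induct) (auto simp: offset_Suc)

lemma offset_disjoint:
  assumes "c < deg F i" "c' < deg F i'" "offset F i + c = offset F i' + c'"
  shows "i = i' \<and> c = c'"
proof -
  have "i = i'"
  proof (rule ccontr)
    assume "i \<noteq> i'"
    then consider "Suc i \<le> i'" | "Suc i' \<le> i" by linarith
    then show False
      by cases (use assms offset_mono[of "Suc i" i' F] offset_mono[of "Suc i'" i F] in \<open>auto simp: offset_Suc\<close>)
  qed
  then show ?thesis using assms by simp
qed

lemma offset_cover: "g < offset F n \<Longrightarrow> \<exists>i<n. \<exists>c<deg F i. g = offset F i + c"
proof (induction n)
  case 0
  then show ?case by (simp add: offset_def)
next
  case (Suc n)
  show ?case
  proof (cases "g < offset F n")
    case True
    then show ?thesis using Suc.IH less_Suc_eq by blast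
  next
    case False
    then show ?thesis using Suc.prems
      by (intro exI[of _ n] conjI exI[of _ "g - offset F n"]) (auto simp: offset_Suc)
  qed
qed

text \<open>A mixed-radix code: dividing by \<open>K\<close> splits off the version
  \<open>j\<close>, and the intervals of length \<open>deg F i\<close> starting at
  \<open>offset F i\<close> are disjoint.\<close>

lemma copy_index_unique:
  assumes "c < deg F i" "c' < deg F i'" "j < K" "j' < K"
  shows "K * (offset F i + c) + j = K * (offset F i' + c') + j' \<longleftrightarrow> i = i' \<and> c = c' \<and> j = j'"
proof
  assume eq: "K * (offset F i + c) + j = K * (offset F i' + c') + j'"
  have "(K * (offset F i + c) + j) div K = offset F i + c" "(K * (offset F i' + c') + j') div K = offset F i' + c'"
    using assms by (simp_all add: div_mult_self4)
  then have "offset F i + c = offset F i' + c'" using eq by simp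
  then show "i = i' \<and> c = c' \<and> j = j'" using offset_disjoint[of c F i c' i'] assms eq by simp
qed simp

lemma copy_index_cover:
  assumes "v < K * offset F n"
  obtains i c j where "i < n" "c < deg F i" "j < K" "v = K * (offset F i + c) + j"
proof -
  have "0 < K" using assms by (cases K) auto
  have "v div K < offset F n" using assms by (simp add: less_mult_imp_div_less mult.commute)
  then obtain i c where "i < n" "c < deg F i" "v div K = offset F i + c" using offset_cover by blast
  then show ?thesis using that[of i c "v mod K"] \<open>0 < K\<close> by (metis mod_less_divisor mult_div_mod_eq)
qed

lemma copy_index_less:
  assumes "i < n" "c < deg F i" "j < K"
  shows "K * (offset F i + c) + j < K * offset F n"
proof -
  have "Suc (offset F i + c) \<le> offset F n"
    using offset_mono[of "Suc i" n F] assms by (simp add: offset_Suc)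
  then have "K * Suc (offset F i + c) \<le> K * offset F n" by (rule mult_le_mono2)
  then show ?thesis using assms by simp
qed

lemma deg_le: "deg F i \<le> length (expand F)"
  by (simp add: deg_def)

lemma deg_pos: "C \<in> set (expand F) \<Longrightarrow> i \<in> set (vars C) \<Longrightarrow> 0 < deg F i"
  by (auto simp: deg_def length_greater_0_conv filter_empty_conv simp del: length_greater_0_conv
      intro!: length_greater_0_conv[THEN iffD2])

lemma set_expand: "C \<in> set (expand F) \<Longrightarrow> C \<in> set (live F)"
  by (auto simp: expand_def)

lemma copy_of_mem_iff:
  assumes "C \<in> set (expand F)" "c < deg F i" "j < K" "j' < K"
  shows "K * (offset F i + c) + j \<in> copy_of F t j' ` set (vars C) \<longleftrightarrow>
    j' = j \<and> i \<in> set (vars C) \<and> t mod deg F i = c"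
proof -
  have "K * (offset F i + c) + j = copy_of F t j' x \<longleftrightarrow> i = x \<and> c = t mod deg F x \<and> j = j'"
    if "x \<in> set (vars C)" for x
    unfolding copy_of_def by (rule copy_index_unique) (use assms deg_pos[OF assms(1) that] in auto)
  then show ?thesis by auto
qed

text \<open>Version \<open>j\<close> of a copy occurs only on the \<open>j\<close>-th variable set
  and only in rounds with \<open>t mod deg F i = c\<close>; each of these uses it in
  \<open>deg F i\<close> constraints.\<close>

lemma degree_main:
  assumes "c < deg F i" "j < K"
  shows "length (filter (\<lambda>C. K * (offset F i + c) + j \<in> set (snd C)) (main F)) = deg F i * uses F i c"
proof -
  let ?v = "K * (offset F i + c) + j"
  have "length (filter (\<lambda>C. ?v \<in> set (snd C))
      (map (\<lambda>C. (tuples C, map (copy_of F t j') (vars C))) (expand F))) =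
      (if j' = j then if t mod deg F i = c then deg F i else 0 else 0)" if "j' < K" for t j'
  proof -
    have "filter (\<lambda>C. ?v \<in> copy_of F t j' ` set (vars C)) (expand F) =
        filter (\<lambda>C. j' = j \<and> i \<in> set (vars C) \<and> t mod deg F i = c) (expand F)"
      using copy_of_mem_iff assms that by (intro filter_cong) auto
    then show ?thesis by (simp add: filter_map comp_def deg_def)
  qed
  then have "length (filter (\<lambda>C. ?v \<in> set (snd C)) (main F)) =
      (\<Sum>t<rounds F. \<Sum>j'<K. if j' = j then if t mod deg F i = c then deg F i else 0 else 0)"
    unfolding main_def length_filter_concat_upt by simp
  also have "\<dots> = (\<Sum>t<rounds F. if t mod deg F i = c then deg F i else 0)"
    using assms by simp
  also have "\<dots> = deg F i * uses F i c"
  proof -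
    have "(\<Sum>t<n. if t mod deg F i = c then deg F i else 0) =
        deg F i * length (filter (\<lambda>t. t mod deg F i = c) [0..<n])" for n
      by (induction n) auto
    then show ?thesis by (simp add: uses_def)
  qed
  finally show ?thesis .
qed

lemma degree_pads:
  assumes "i < fst F" "c < deg F i" "j < K"
  shows "length (filter (\<lambda>C. K * (offset F i + c) + j \<in> set (snd C)) (pads F)) = deficit F i c"
proof -
  let ?v = "K * (offset F i + c) + j"
  have "length (filter (\<lambda>C. ?v \<in> set (snd C)) (map (\<lambda>_. (P, map (\<lambda>j. K * (offset F i' + c') + j) [0..<K]))
      [0..<deficit F i' c'])) = (if i' = i then if c' = c then deficit F i c else 0 else 0)"
    if "c' < deg F i'" for i' c'
  proof -
    have "?v \<in> set (map (\<lambda>j. K * (offset F i' + c') + j) [0..<K]) \<longleftrightarrow> i' = i \<and> c' = c"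
      unfolding set_map set_upt image_iff
      using copy_index_unique[OF assms(2) that assms(3)] assms(3) by (auto simp del: image_add_atLeastLessThan)
    then show ?thesis unfolding filter_map comp_def snd_conv by simp
  qed
  then have "length (filter (\<lambda>C. ?v \<in> set (snd C)) (pads F)) =
      (\<Sum>i'<fst F. \<Sum>c'<deg F i'. if i' = i then if c' = c then deficit F i c else 0 else 0)"
    unfolding pads_def length_filter_concat_upt by simp
  also have "\<dots> = (\<Sum>i'<fst F. if i' = i then \<Sum>c'<deg F i'. if c' = c then deficit F i c else 0 else 0)"
    by (intro sum.cong) auto
  also have "\<dots> = deficit F i c" using assms by simp
  finally show ?thesis .
qed

lemma deg_mult_uses:
  assumes "c < deg F i"
  shows "deg F i * uses F i c \<le> rounds F + length (expand F)"
    "rounds F \<le> deg F i * uses F i c + length (expand F)"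
  using length_filter_mod_upt_bounds[OF assms, of "rounds F"] deg_le[of F i]
  unfolding uses_def by linarith+

lemma degree_built:
  assumes "v < K * offset F (fst F)"
  shows "length (filter (\<lambda>C. v \<in> set (snd C)) (main F @ pads F)) = rounds F + length (expand F)"
proof -
  obtain i c j where v: "i < fst F" "c < deg F i" "j < K" "v = K * (offset F i + c) + j"
    using copy_index_cover[OF assms] .
  show ?thesis using degree_main[OF v(2,3)] degree_pads[OF v(1-3)] deg_mult_uses[OF v(2)]
    by (simp add: v(4) deficit_def)
qed

lemma rounds_pos: "expand F \<noteq> [] \<Longrightarrow> 0 < rounds F"
  by (simp add: rounds_def)

lemma length_main: "length (main F) = rounds F * K * length (expand F)"
  unfolding main_def length_concat_upt by simp

text \<open>A degree falls short of \<open>rounds F\<close> by at most \<open>?m\<close>, and the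
  target lies \<open>?m\<close> above, so each deficit is at most \<open>2 * ?m\<close>. There are
  at most \<open>?m\<close> groups per variable.\<close>

lemma length_pads: "length (pads F) \<le> rounds F"
proof -
  let ?m = "length (expand F)"
  have "length (pads F) = (\<Sum>i<fst F. \<Sum>c<deg F i. deficit F i c)"
    unfolding pads_def length_concat_upt by simp
  also have "\<dots> \<le> (\<Sum>i<fst F. \<Sum>c<deg F i. 2 * ?m)"
  proof (intro sum_mono)
    fix i c assume "c \<in> {..<deg F i}"
    then show "deficit F i c \<le> 2 * ?m"
      using deg_mult_uses(2)[of c F i] by (simp add: deficit_def)
  qed
  also have "\<dots> \<le> (\<Sum>i<fst F. ?m * (2 * ?m))"
    by (intro sum_mono) (simp add: deg_le)
  also have "\<dots> \<le> rounds F" by (simp add: rounds_def algebra_simps)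
  finally show ?thesis .
qed

lemma regularized_eq:
  assumes "expand F \<noteq> []"
  shows "fst (regularized F) = K * offset F (fst F)"
    "snd (regularized F) = map (\<lambda>C. (fst C, snd C, 1, length (main F @ pads F))) (main F @ pads F)"
  using assms by (simp_all add: regularized_def)

lemma regularized_nonempty:
  assumes "expand F \<noteq> []" "0 < K"
  shows "snd (regularized F) \<noteq> []"
proof -
  have "0 < length (main F)" using rounds_pos[OF assms(1)] assms by (simp add: length_main)
  then show ?thesis by (simp add: regularized_eq[OF assms(1)])
qed

section \<open>Comparing assignments of the two instances\<close>

lemma nth0_candidate: "i < fst F \<Longrightarrow> nth0 (candidate F X t j) i = nth0 X (copy_of F t j i)"
  by (simp add: nth0_def candidate_def)

lemma candidate_in_candidates:
  assumes "t < rounds F" "j < K"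
  shows "candidate F X t j \<in> set (candidates F X)"
proof -
  have "candidate F X t j \<in> set (map (candidate F X t) [0..<K])" using assms by simp
  then show ?thesis using assms unfolding candidates_def set_simps set_concat set_map set_upt by fastforce
qed

text \<open>Each pair of a round and a variable set carries a copy of \<open>expand F\<close>, on
  which \<open>X\<close> acts as the candidate read off there.\<close>

lemma length_filter_main:
  assumes wf: "wf q F"
  shows "length (filter (\<lambda>C. map (nth0 X) (snd C) \<in> set (fst C)) (main F)) =
    (\<Sum>t<rounds F. \<Sum>j<K. score F (candidate F X t j))"
proof -
  have "length (filter (\<lambda>C. map (nth0 X) (snd C) \<in> set (fst C))
      (map (\<lambda>C. (tuples C, map (copy_of F t j) (vars C))) (expand F))) = score F (candidate F X t j)" for t j
  proof -
    have eq: "map (nth0 X \<circ> copy_of F t j) (vars C) = map (nth0 (candidate F X t j)) (vars C)"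
      if "C \<in> set (expand F)" for C
      using wf set_live[OF set_expand[OF that]] by (auto simp: wf_def nth0_candidate subset_iff)
    have "filter (\<lambda>C. map (nth0 X \<circ> copy_of F t j) (vars C) \<in> set (tuples C)) (expand F) =
        filter (sat (candidate F X t j)) (expand F)"
      by (intro filter_cong refl) (simp only: sat_def eq)
    then show ?thesis by (simp add: filter_map comp_def score_def)
  qed
  then show ?thesis unfolding main_def length_filter_concat_upt by simp
qed

lemma length_filter_sat_regularized:
  assumes "expand F \<noteq> []"
  shows "length (filter (sat X) (snd (regularized F))) =
    length (filter (\<lambda>C. map (nth0 X) (snd C) \<in> set (fst C)) (main F)) +
    length (filter (\<lambda>C. map (nth0 X) (snd C) \<in> set (fst C)) (pads F))"
  by (simp add: regularized_eq[OF assms] filter_map comp_def sat_def)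

text \<open>Every copy gets the value of the variable it belongs to. Scores agree, but assignments
  may not: a variable in no expanded constraint has no copies, and a candidate gives it an unrelated
  value.\<close>

lemma lifted_assignment:
  assumes wf: "wf q F" and \<chi>: "length \<chi> = fst F" "set \<chi> \<subseteq> {..<q}"
  obtains X where "length X = K * offset F (fst F)" "set X \<subseteq> {..<q}"
    "\<And>t j. j < K \<Longrightarrow> score F (candidate F X t j) = score F \<chi>"
proof -
  define owner where "owner v = (SOME i. i < fst F \<and> (\<exists>c<deg F i. \<exists>j<K. v = K * (offset F i + c) + j))" for v
  have owner_ex: "\<exists>i. i < fst F \<and> (\<exists>c<deg F i. \<exists>j<K. v = K * (offset F i + c) + j)"
    if "v < K * offset F (fst F)" for v using copy_index_cover[OF that] by metis
  define X where "X = map (\<lambda>v. \<chi> ! owner v) [0..<K * offset F (fst F)]"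
  have owner: "owner (K * (offset F i + c) + j) = i" if "i < fst F" "c < deg F i" "j < K" for i c j
    using someI_ex[OF owner_ex[OF copy_index_less[OF that]]] copy_index_unique[of c F i] that
    unfolding owner_def[symmetric] by metis
  have "set X \<subseteq> {..<q}"
  proof
    fix x assume "x \<in> set X"
    then obtain v where v: "v < K * offset F (fst F)" "x = \<chi> ! owner v" by (auto simp: X_def)
    have "owner v < length \<chi>" using someI_ex[OF owner_ex[OF v(1)]] \<chi>(1) unfolding owner_def[symmetric] by simp
    from nth_mem[OF this] show "x \<in> {..<q}" using v(2) \<chi>(2) by (auto simp del: nth_mem)
  qed
  moreover have "score F (candidate F X t j) = score F \<chi>" if "j < K" for t j
  proof -
    have "nth0 (candidate F X t j) i = nth0 \<chi> i" if C: "C \<in> set (expand F)" and i: "i \<in> set (vars C)" for C i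
    proof -
      have "i < fst F" using wf set_live[OF set_expand[OF C]] i by (auto simp: wf_def)
      moreover have "t mod deg F i < deg F i" using deg_pos[OF C i] by simp
      ultimately show ?thesis using owner[of i "t mod deg F i" j] copy_index_less[of i "fst F" "t mod deg F i" F j] \<open>j < K\<close> \<chi>(1)
        by (simp add: nth0_def candidate_def X_def copy_of_def)
    qed
    then have "filter (sat (candidate F X t j)) (expand F) = filter (sat \<chi>) (expand F)"
      by (intro filter_cong) (auto simp: sat_def cong: map_cong)
    then show ?thesis by (simp add: score_def)
  qed
  ultimately show ?thesis using that[of X] by (simp add: X_def)
qed

lemma candidates_valid:
  assumes "0 < q" "set X \<subseteq> {..<q}" "\<chi> \<in> set (candidates F X)"
  shows "length \<chi> = fst F \<and> set \<chi> \<subseteq> {..<q}"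
proof -
  have "nth0 X i < q" for i
    using assms(1,2) nth_mem[of i X] by (auto simp: nth0_def simp del: nth_mem)
  then show ?thesis using assms(1,3) by (auto simp: candidates_def candidate_def)
qed

text \<open>On the lift of \<chi> all \<open>rounds F * K\<close> blocks have the score of \<chi>.
  On \<open>X\<close> no block beats the decoded assignment, and the padding adds at most
  \<open>rounds F\<close>, that is, at most one per block because \<open>K\<close> is positive.
  Dividing by the number of blocks leaves the \<open>+ 1\<close>.\<close>

lemma score_decode_ge:
  fixes \<alpha> :: real
  assumes wf: "wf q F" and ne: "expand F \<noteq> []" and K: "0 < K" and \<alpha>: "0 \<le> \<alpha>"
    and \<chi>: "length \<chi> = fst F" "set \<chi> \<subseteq> {..<q}"
    and X: "\<And>Y. length Y = fst (regularized F) \<Longrightarrow> set Y \<subseteq> {..<q} \<Longrightarrow>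
      \<alpha> * real (length (filter (sat Y) (snd (regularized F)))) \<le> real (length (filter (sat X) (snd (regularized F))))"
  shows "\<alpha> * real (score F \<chi>) \<le> real (score F (decode F X)) + 1"
proof -
  let ?TK = "real (rounds F) * real K"
  obtain Y where Y: "length Y = K * offset F (fst F)" "set Y \<subseteq> {..<q}"
    "\<And>t j. j < K \<Longrightarrow> score F (candidate F Y t j) = score F \<chi>"
    using lifted_assignment[OF wf \<chi>] by blast
  have "rounds F * K * score F \<chi> \<le> length (filter (sat Y) (snd (regularized F)))"
    unfolding length_filter_sat_regularized[OF ne] length_filter_main[OF wf] using Y(3) by simp
  then have "?TK * real (score F \<chi>) \<le> real (length (filter (sat Y) (snd (regularized F))))"
    by (metis of_nat_le_iff of_nat_mult)
  then have "\<alpha> * (?TK * real (score F \<chi>)) \<le> \<alpha> * real (length (filter (sat Y) (snd (regularized F))))"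
    using \<alpha> by (rule mult_left_mono)
  also have "\<dots> \<le> real (length (filter (sat X) (snd (regularized F))))"
    by (rule X) (use Y regularized_eq[OF ne] in auto)
  also have "\<dots> \<le> real (rounds F * K * score F (decode F X) + rounds F)"
  proof -
    have "(\<Sum>t<rounds F. \<Sum>j<K. score F (candidate F X t j)) \<le> (\<Sum>t<rounds F. \<Sum>j<K. score F (decode F X))"
      by (intro sum_mono decode_best candidate_in_candidates) auto
    moreover have "length (filter (\<lambda>C. map (nth0 X) (snd C) \<in> set (fst C)) (pads F)) \<le> rounds F"
      using length_pads[of F] le_trans length_filter_le by blast
    ultimately show ?thesis
      unfolding length_filter_sat_regularized[OF ne] length_filter_main[OF wf] of_nat_le_iff by simp
  qed
  also have "\<dots> \<le> ?TK * (real (score F (decode F X)) + 1)"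
  proof -
    have "real (rounds F) * 1 \<le> ?TK" using K by (intro mult_left_mono) auto
    then show ?thesis by (simp add: algebra_simps)
  qed
  finally have "?TK * (\<alpha> * real (score F \<chi>)) \<le> ?TK * (real (score F (decode F X)) + 1)"
    by (simp add: algebra_simps)
  moreover have "0 < ?TK" using rounds_pos[OF ne] K by simp
  ultimately show ?thesis by (simp only: mult_le_cancel_left_pos)
qed

section \<open>The output of the reduction encodes a regular instance\<close>

lemma regularized_uniform:
  "C \<in> set (snd (regularized F)) \<Longrightarrow> num C = 1 \<and> den C = length (snd (regularized F))"
  by (auto simp: regularized_def split: if_splits)

lemma regularized_realizable:
  assumes wf: "wf q F" and K: "0 < K"
    and Q: "Q \<in> \<Lambda>" "arity Q = K" "sat_tuples q Q = P"
    and F: "\<And>C. C \<in> set (snd F) \<Longrightarrow> \<exists>Q\<in>\<Lambda>. arity Q = length (vars C) \<and> sat_tuples q Q = tuples C"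
  shows "\<exists>G \<in> unweighted_regular_instances \<Lambda>. raw q G = regularized F"
proof (cases "expand F = []")
  case True
  show ?thesis
    \<comment> \<open>Degree 1: the stand-in is a single constraint on all of its \<open>K\<close>
      variables.\<close>
    by (rule unweighted_regular_instance_of_raw[of "regularized F" \<Lambda> q 1])
       (use True Q in \<open>auto simp: regularized_def\<close>)
next
  case ne: False
  let ?B = "main F @ pads F"
  have "snd (regularized F) \<noteq> []" by (rule regularized_nonempty[OF ne K])
  moreover have "(\<exists>Q\<in>\<Lambda>. arity Q = length (vars C) \<and> sat_tuples q Q = tuples C) \<and>
      distinct (vars C) \<and> set (vars C) \<subseteq> {..<fst (regularized F)} \<and> num C = 1 \<and> den C = length (snd (regularized F))"
    if C: "C \<in> set (snd (regularized F))" for C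
  proof -
    have B: "(tuples C, vars C) \<in> set ?B" using C by (auto simp: regularized_eq[OF ne])
    consider (main) t j D where "D \<in> set (expand F)" "j < K" "tuples C = tuples D" "vars C = map (copy_of F t j) (vars D)"
      | (pad) i c where "i < fst F" "c < deg F i" "tuples C = P" "vars C = map (\<lambda>j. K * (offset F i + c) + j) [0..<K]"
    proof (cases "(tuples C, vars C) \<in> set (main F)")
      case True
      then obtain t j D where "D \<in> set (expand F)" "j < K"
        "(tuples C, vars C) = (tuples D, map (copy_of F t j) (vars D))"
        unfolding main_def set_concat set_map set_upt by fastforce
      then show ?thesis using that(1) by blast
    next
      case False
      then have "(tuples C, vars C) \<in> set (pads F)" using B by simp
      then obtain i c where "i < fst F" "c < deg F i"
        "(tuples C, vars C) = (P, map (\<lambda>j. K * (offset F i + c) + j) [0..<K])"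
        unfolding pads_def set_concat set_map set_upt by fastforce
      then show ?thesis using that(2) by blast
    qed
    then have "(\<exists>Q\<in>\<Lambda>. arity Q = length (vars C) \<and> sat_tuples q Q = tuples C) \<and>
      distinct (vars C) \<and> set (vars C) \<subseteq> {..<fst (regularized F)}"
    proof cases
      case main
      have D: "D \<in> set (snd F)" "distinct (vars D)" "set (vars D) \<subseteq> {..<fst F}"
        using wf set_live[OF set_expand[OF main(1)]] by (auto simp: wf_def)
      have pos: "t mod deg F i < deg F i" if "i \<in> set (vars D)" for i
        using deg_pos[OF main(1) that] by simp
      have "inj_on (copy_of F t j) (set (vars D))"
        by (rule inj_onI) (simp add: copy_of_def copy_index_unique pos main(2) del: add_right_cancel)
      moreover have "copy_of F t j i < K * offset F (fst F)" if "i \<in> set (vars D)" for i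
        unfolding copy_of_def using copy_index_less[of i "fst F" "t mod deg F i" F j] pos[OF that] D that main(2) by auto
      ultimately show ?thesis using F[OF D(1)] D main by (auto simp: distinct_map regularized_eq[OF ne])
    next
      case pad
      then show ?thesis using Q copy_index_less[OF pad(1,2)]
        by (auto simp: distinct_map inj_on_def regularized_eq[OF ne] simp del: image_add_atLeastLessThan)
    qed
    then show ?thesis using regularized_uniform[OF C] by blast
  qed
  moreover have "length (filter (\<lambda>C. v \<in> set (vars C)) (snd (regularized F))) = rounds F + length (expand F)"
    if "v < fst (regularized F)" for v
    using degree_built[of v F] that by (simp add: regularized_eq[OF ne] filter_map comp_def)
  ultimately show ?thesis
    by (rule unweighted_regular_instance_of_raw)
qed

end

subsection \<open>Correctness\<close>

text \<open>A program for a search problem settles on one solution per input, hence computes a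
  function. This brings the assumed algorithm under the closure properties.\<close>

lemma solves_in_poly_time_iff:
  "(\<exists>A. solves_in_poly_time A e S R) \<longleftrightarrow> (\<exists>f. ptime_on S e f \<and> (\<forall>x\<in>S. R x (f x)))"
proof
  assume "\<exists>A. solves_in_poly_time A e S R"
  then obtain A p where "\<forall>x\<in>S. \<exists>t s. exec A (initial_store (e x)) t s \<and> t \<le> poly p (tree_size (e x)) \<and> R x (s 0)"
    unfolding solves_in_poly_time_def by blast
  then obtain s where s: "\<forall>x\<in>S. \<exists>t. exec A (initial_store (e x)) t (s x) \<and> t \<le> poly p (tree_size (e x)) \<and> R x (s x 0)"
    by metis
  then have "ptime_on S e (\<lambda>x. s x 0)"
    unfolding ptime_on_def solves_in_poly_time_def by blast
  then show "\<exists>f. ptime_on S e f \<and> (\<forall>x\<in>S. R x (f x))" using s by blast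
next
  assume "\<exists>f. ptime_on S e f \<and> (\<forall>x\<in>S. R x (f x))"
  then show "\<exists>A. solves_in_poly_time A e S R"
    unfolding ptime_on_def solves_in_poly_time_def by metis
qed

lemma ex_approximation_algorithm_iff:
  "(\<exists>A. approximation_algorithm q \<F> \<alpha> A) \<longleftrightarrow>
    (\<exists>f. ptime_on \<F> (enc_instance q) (\<lambda>F. enc_assignment (f F)) \<and>
      (\<forall>F\<in>\<F>. f F \<in> assignments q F \<and> \<alpha> * Opt q F \<le> Val (f F) F))"
  unfolding approximation_algorithm_def solves_in_poly_time_iff
proof
  assume "\<exists>f. ptime_on \<F> (enc_instance q) f \<and>
    (\<forall>F\<in>\<F>. \<exists>\<chi>\<in>assignments q F. f F = enc_assignment \<chi> \<and> \<alpha> * Opt q F \<le> Val \<chi> F)"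
  then obtain f g where f: "ptime_on \<F> (enc_instance q) f"
    and g: "\<forall>F\<in>\<F>. g F \<in> assignments q F \<and> f F = enc_assignment (g F) \<and> \<alpha> * Opt q F \<le> Val (g F) F"
    by metis
  have "ptime_on \<F> (enc_instance q) (\<lambda>F. enc_assignment (g F))"
    by (rule ptime_on_cong[OF f]) (use g in simp)
  then show "\<exists>f. ptime_on \<F> (enc_instance q) (\<lambda>F. enc_assignment (f F)) \<and>
      (\<forall>F\<in>\<F>. f F \<in> assignments q F \<and> \<alpha> * Opt q F \<le> Val (f F) F)" using g by blast
qed blast

lemma ptime_on_raw:
  "ptime enc_rinst f \<Longrightarrow> ptime_on S (enc_instance q) (\<lambda>F. f (raw q F))"
  by (rule ptime_on_comp[where E'=enc_rinst and S'=UNIV]) (auto simp: ptime_on_id simp flip: enc_instance_raw)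

lemma rval_nonneg: "0 \<le> rval \<chi> F"
  unfolding rval_def by (rule sum_list_nonneg) (auto simp: wt_def)

lemma Opt_nonneg:
  assumes "F \<in> weighted_instances \<Lambda>" "0 < q"
  shows "0 \<le> Opt q F"
proof -
  obtain \<chi> where "\<chi> \<in> assignments q F" "Val \<chi> F = Opt q F" using Opt_attained[OF assms(2)] .
  then show ?thesis using Val_raw[OF assms(1)] rval_nonneg by metis
qed

text \<open>Serves the degenerate cases, in which a constant answer is good enough.\<close>

lemma zero_assignment_algorithm:
  assumes q: "0 < q" and S: "S \<subseteq> weighted_instances \<Lambda>"
    and good: "\<And>F. F \<in> S \<Longrightarrow> \<alpha> * Opt q F \<le> Val (map (\<lambda>_. 0) [0..<nvars F]) F"
  shows "\<exists>B. approximation_algorithm q S \<alpha> B"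
  unfolding ex_approximation_algorithm_iff
proof (intro exI conjI ballI)
  have "ptime enc_rinst (\<lambda>F. enc_tuple (map (\<lambda>_. 0) [0..<fst F]))"
    by (rule ptime_unary_const ptime_map ptime_upt ptime_vars)+
  from ptime_on_raw[OF this] show "ptime_on S (enc_instance q) (\<lambda>F. enc_assignment (map (\<lambda>_. 0) [0..<nvars F]))"
    by (simp add: enc_assignment_def raw_def)
  show "map (\<lambda>_. 0) [0..<nvars F] \<in> assignments q F" for F
    using q by (auto simp: assignments_def)
qed (rule good)

text \<open>Over the empty alphabet an instance with a variable has no assignment to output. A
  predicate of any weighted instance would yield a regular instance of this kind, on which the
  assumed algorithm cannot succeed.\<close>

lemma weighted_instances_empty:
  assumes "\<exists>A. approximation_algorithm 0 (unweighted_regular_instances \<Lambda>) \<alpha> A"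
  shows "weighted_instances \<Lambda> = {}"
proof (rule ccontr)
  assume "weighted_instances \<Lambda> \<noteq> {}"
  then obtain F where F: "F \<in> weighted_instances \<Lambda>" by blast
  then have "constraints F \<noteq> []" by (auto simp: weighted_instances_def)
  then obtain C where "C \<in> set (constraints F)" by (meson last_in_set)
  then have "pred C \<in> \<Lambda>" using F by (auto simp: weighted_instances_def)
  \<comment> \<open>For arity 0 an idle variable is added; it has degree 0, so the instance is still
    regular.\<close>
  define n where "n = (if arity (pred C) = 0 then 1 else arity (pred C))"
  define G where "G = \<lparr>nvars = n, constraints = [\<lparr>pred = pred C, scope = [0..<arity (pred C)], weight = 1\<rparr>]\<rparr>"
  have "G \<in> unweighted_regular_instances \<Lambda>"
    using \<open>pred C \<in> \<Lambda>\<close>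
    by (auto simp: G_def n_def unweighted_regular_instances_def weighted_instances_def unweighted_def regular_def degree_of_def)
  moreover have "assignments 0 G = {}" by (auto simp: G_def n_def assignments_def)
  ultimately show False using assms unfolding ex_approximation_algorithm_iff by blast
qed

lemma reduction_correct:
  fixes \<alpha> \<delta> :: real
  assumes q: "0 < q" and \<alpha>: "0 \<le> \<alpha>" "\<alpha> < 1" and \<delta>: "1 \<le> \<delta> * real L" and L: "0 < L" and K: "0 < K"
    and F: "F \<in> weighted_instances \<Lambda>"
    and G: "G \<in> unweighted_regular_instances \<Lambda>" "raw q G = reduction.regularized L K P (raw q F)"
    and X: "X \<in> assignments q G" "\<alpha> * Opt q G \<le> Val X G"
  defines "\<chi> \<equiv> reduction.decode L K (raw q F) X"
  shows "\<chi> \<in> assignments q F \<and> (\<alpha> - \<delta>) * Opt q F \<le> Val \<chi> F"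
proof -
  interpret reduction L K P .
  let ?F = "raw q F"
  have wf: "wf q ?F" using F by (rule wf_raw)
  have "set X \<subseteq> {..<q}" using X by (simp add: assignments_def)
  from candidates_valid[OF q this decode_in_candidates]
  have \<chi>: "\<chi> \<in> assignments q F" by (auto simp: \<chi>_def assignments_def raw_def)
  obtain \<chi>' where \<chi>': "\<chi>' \<in> assignments q F" "Val \<chi>' F = Opt q F" using Opt_attained[OF q] .
  have V: "Val \<chi> F = rval \<chi> ?F" "Opt q F = rval \<chi>' ?F"
    using Val_raw[OF F] \<chi> \<chi>' by auto
  have "(\<alpha> - \<delta>) * Opt q F \<le> Val \<chi> F"
  proof (cases "live ?F = []")
    case True
    then show ?thesis unfolding V rval_live by simp
  next
    case live: False
    define W where "W = Max (wt ` set (live ?F))"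
    note ctx = wf live L W_def
    have ne: "expand ?F \<noteq> []" by (rule expand_nonempty[OF ctx])
    let ?m = "real (length (snd ?F))" and ?M = "real (precision ?F)"
    have M: "?M = (?m + 1) * real L" by (simp add: precision_def algebra_simps)
    have W_le: "W \<le> Opt q F"
    proof -
      obtain C where C: "C \<in> set (live ?F)" "wt C = W" using W_attained[OF ctx] by blast
      obtain \<psi> where "length \<psi> = fst ?F" "set \<psi> \<subseteq> {..<q}" "wt C \<le> rval \<psi> ?F"
        using weight_le_rval_attained[OF wf q C(1)] .
      moreover from this have "\<psi> \<in> assignments q F" by (simp add: assignments_def raw_def)
      ultimately show ?thesis using Val_le_Opt[of \<psi> q F] Val_raw[OF F, of \<psi> q] C by simp
    qed
    have GW: "G \<in> weighted_instances \<Lambda>" using G by (simp add: unweighted_regular_instances_def)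
    let ?R = "regularized ?F"
    have Val_G: "Val Y G = real (length (filter (sat Y) (snd ?R))) / real (length (snd ?R))"
      if "Y \<in> assignments q G" for Y
      using Val_raw[OF GW that] rval_uniform[OF regularized_uniform] G(2) by simp
    have len: "0 < real (length (snd ?R))"
      using regularized_nonempty[OF ne K] by simp
    have "\<alpha> * real (score ?F \<chi>') \<le> real (score ?F \<chi>) + 1"
      unfolding \<chi>_def
    proof (rule score_decode_ge[OF wf ne K \<alpha>(1)])
      show "length \<chi>' = fst ?F" "set \<chi>' \<subseteq> {..<q}" using \<chi>' by (auto simp: assignments_def raw_def)
      fix Y assume "length Y = fst ?R" "set Y \<subseteq> {..<q}"
      then have Y: "Y \<in> assignments q G" using G(2)[symmetric] by (simp add: assignments_def raw_def)
      have "\<alpha> * Val Y G \<le> \<alpha> * Opt q G" using Val_le_Opt[OF Y] \<alpha> by (simp add: mult_left_mono)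
      then have "\<alpha> * Val Y G \<le> Val X G" using X by simp
      then show "\<alpha> * real (length (filter (sat Y) (snd ?R))) \<le> real (length (filter (sat X) (snd ?R)))"
        unfolding Val_G[OF Y] Val_G[OF X(1)] using len by (simp add: divide_le_cancel)
    qed
    then have "W * (\<alpha> * real (score ?F \<chi>')) \<le> W * (real (score ?F \<chi>) + 1)"
      using W_pos[OF ctx] by simp
    moreover have "W * real (score ?F \<chi>) \<le> ?M * Val \<chi> F"
      unfolding V by (rule score_bounds(1)[OF ctx])
    moreover have "\<alpha> * (?M * Opt q F) \<le> \<alpha> * (W * (real (score ?F \<chi>') + ?m))"
      unfolding V using score_bounds(2)[OF ctx] \<alpha> by (simp add: mult_left_mono)
    moreover have "\<alpha> * (W * ?m) \<le> 1 * (W * ?m)"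
      using \<alpha> W_pos[OF ctx] by (intro mult_right_mono) auto
    \<comment> \<open>The loss so far, in units of \<open>W\<close>: \<open>?m\<close> from rounding
      and one from padding.\<close>
    ultimately have "\<alpha> * (?M * Opt q F) \<le> ?M * Val \<chi> F + W * (?m + 1)"
      by (simp add: algebra_simps)
    \<comment> \<open>Here \<open>W \<le> Opt\<close> and the choice of \<open>L\<close> enter; as
      \<open>?M\<close> is \<open>(?m + 1) * L\<close>, the loss turns into
      \<open>\<delta> * ?M * Opt\<close>.\<close>
    also have "W * (?m + 1) \<le> Opt q F * (?m + 1) * (\<delta> * real L)"
    proof -
      have "W * (?m + 1) * 1 \<le> Opt q F * (?m + 1) * (\<delta> * real L)"
        using W_le \<delta> W_pos[OF ctx] by (intro mult_mono) auto
      then show ?thesis by simp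
    qed
    finally have "?M * ((\<alpha> - \<delta>) * Opt q F) \<le> ?M * Val \<chi> F"
      unfolding M by (simp add: algebra_simps)
    moreover have "0 < ?M" using L by (simp add: M)
    ultimately show ?thesis by simp
  qed
  then show ?thesis using \<chi> by blast
qed

theorem theorem1:
  fixes q :: nat and \<Lambda> :: "predicate set" and \<alpha> :: real
  assumes "finite \<Lambda>"
    and "\<alpha> < 1"
    and "\<exists>A. approximation_algorithm q (unweighted_regular_instances \<Lambda>) \<alpha> A"
  shows "\<forall>\<delta>>0. \<exists>B. approximation_algorithm q (weighted_instances \<Lambda>) (\<alpha> - \<delta>) B"
proof (intro allI impI)
  fix \<delta> :: real assume \<delta>: "0 < \<delta>"
  \<comment> \<open>The last case is the reduction. It multiplies inequalities by \<alpha>, hence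
    \<open>0 \<le> \<alpha>\<close>, and pads with \<open>Q\<close>, hence the positive arity; if
    all arities are 0, all assignments have the same value.\<close>
  consider "q = 0" | "0 < q" "\<alpha> < 0" | "0 < q" "\<forall>Q\<in>\<Lambda>. arity Q = 0"
    | Q where "0 < q" "0 \<le> \<alpha>" "Q \<in> \<Lambda>" "0 < arity Q"
    by fastforce
  then show "\<exists>B. approximation_algorithm q (weighted_instances \<Lambda>) (\<alpha> - \<delta>) B"
  proof cases
    case 1
    then have "weighted_instances \<Lambda> = {}" using weighted_instances_empty assms(3) by simp
    then show ?thesis unfolding approximation_algorithm_def solves_in_poly_time_def by simp
  next
    case 2
    show ?thesis
    proof (rule zero_assignment_algorithm[OF 2(1) order_refl])
      fix F assume F: "F \<in> weighted_instances \<Lambda>"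
      have "map (\<lambda>_. 0) [0..<nvars F] \<in> assignments q F" using 2 by (auto simp: assignments_def)
      then have "0 \<le> Val (map (\<lambda>_. 0) [0..<nvars F]) F"
        using Val_raw[OF F] rval_nonneg by simp
      moreover have "(\<alpha> - \<delta>) * Opt q F \<le> 0"
        using 2 \<delta> Opt_nonneg[OF F 2(1)] by (intro mult_nonpos_nonneg) auto
      ultimately show "(\<alpha> - \<delta>) * Opt q F \<le> Val (map (\<lambda>_. 0) [0..<nvars F]) F" by linarith
    qed
  next
    case 3
    show ?thesis
    proof (rule zero_assignment_algorithm[OF 3(1) order_refl])
      fix F assume F: "F \<in> weighted_instances \<Lambda>"
      then have "scope C = []" if "C \<in> set (constraints F)" for C
        using 3(2) that by (force simp: weighted_instances_def)
      then have "Val \<psi> F = Val \<psi>' F" for \<psi> \<psi>'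
        unfolding Val_def by (intro arg_cong[of _ _ sum_list] map_cong) auto
      then have "Val (map (\<lambda>_. 0) [0..<nvars F]) F = Opt q F"
        using Opt_attained[OF 3(1)] by metis
      moreover have "(\<alpha> - \<delta>) * Opt q F \<le> 1 * Opt q F"
        using assms(2) \<delta> Opt_nonneg[OF F 3(1)] by (intro mult_right_mono) auto
      ultimately show "(\<alpha> - \<delta>) * Opt q F \<le> Val (map (\<lambda>_. 0) [0..<nvars F]) F" by simp
    qed
  next
    case 4
    define K where "K = arity Q"
    define P where "P = sat_tuples q Q"
    define L where "L = nat \<lceil>1 / \<delta>\<rceil>"
    interpret reduction L K P .
    have "1 / \<delta> \<le> real L" unfolding L_def by (rule real_nat_ceiling_ge)
    then have L1: "1 \<le> \<delta> * real L" using \<delta> by (simp add: field_simps)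
    then have L0: "0 < L" by (cases L) auto
    have K: "0 < K" using 4 by (simp add: K_def)
    obtain f where f: "ptime_on (unweighted_regular_instances \<Lambda>) (enc_instance q) (\<lambda>G. enc_assignment (f G))"
      "\<And>G. G \<in> unweighted_regular_instances \<Lambda> \<Longrightarrow> f G \<in> assignments q G \<and> \<alpha> * Opt q G \<le> Val (f G) G"
      using assms(3) unfolding ex_approximation_algorithm_iff by blast
    have "\<exists>G \<in> unweighted_regular_instances \<Lambda>. raw q G = regularized (raw q F)"
      if F: "F \<in> weighted_instances \<Lambda>" for F
    proof (rule regularized_realizable[OF wf_raw[OF F] K 4(3)])
      fix C assume "C \<in> set (snd (raw q F))"
      then show "\<exists>Q\<in>\<Lambda>. arity Q = length (vars C) \<and> sat_tuples q Q = tuples C"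
        using F by (auto simp: raw_def raw_con_def weighted_instances_def)
    qed (simp_all add: K_def P_def)
    \<comment> \<open>\<open>g\<close> comes from the axiom of choice. The algorithm computes only
      the encoding of \<open>g F\<close>, which is that of
      \<open>regularized (raw q F)\<close>.\<close>
    then obtain g where g: "\<And>F. F \<in> weighted_instances \<Lambda> \<Longrightarrow>
        g F \<in> unweighted_regular_instances \<Lambda> \<and> raw q (g F) = regularized (raw q F)"
      by metis
    let ?S = "weighted_instances \<Lambda>"
    have "ptime_on ?S (enc_instance q) (\<lambda>F. enc_instance q (g F))"
      by (rule ptime_on_cong[OF ptime_on_raw[OF ptime_regularized]]) (simp add: enc_instance_raw g)
    from ptime_on_comp[OF f(1) this]
    have "ptime_on ?S (enc_instance q) (\<lambda>F. enc_tuple (f (g F)))"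
      using g by (auto simp: enc_assignment_def)
    from ptime_on_Node[OF ptime_on_raw[OF ptime_on_id] this]
    have "ptime_on ?S (enc_instance q) (\<lambda>F. enc_pair enc_rinst enc_tuple (raw q F, f (g F)))"
      by (simp add: enc_pair_def)
    from ptime_on_comp[OF ptime_decode this]
    have "ptime_on ?S (enc_instance q) (\<lambda>F. enc_assignment (decode (raw q F) (f (g F))))"
      by (simp add: enc_assignment_def)
    moreover have "decode (raw q F) (f (g F)) \<in> assignments q F \<and>
        (\<alpha> - \<delta>) * Opt q F \<le> Val (decode (raw q F) (f (g F))) F" if "F \<in> ?S" for F
      using reduction_correct[OF 4(1,2) assms(2) L1 L0 K that, of "g F" P "f (g F)"] g[OF that] f(2)
      by blast
    ultimately show ?thesis unfolding ex_approximation_algorithm_iff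
      by (intro exI[of _ "\<lambda>F. decode (raw q F) (f (g F))"]) blast
  qed
qed

end
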